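(* Let $M$ be a matroid, and let $\mathscr{G}$ be a building set in its lattice of flats. Then \[ Z_M(q,T) = q^{-\operatorname{rk} M} \sum_{\mathcal{S} \in \mathcal{N}(M,\mathscr{G})} \frac{\chi_{M_{\mathcal{S}}}(q)}{(q-1)^{\#\mathcal{S}}} \prod_{F \in \mathcal{S} } (q-1) \frac{q^{-\operatorname{rk} F}T^{\#F}}{1 - q^{-\operatorname{rk} F}T^{\#F}}, \] \[ Z_M^0(q,T) = q^{-\operatorname{rk} M} \sum_{\mathcal{S} \in \mathcal{N}^*(M,\mathscr{G})} \frac{\chi_{M_{\mathcal{S}}}(q)}{(q-1)^{\#\mathcal{S}}} \prod_{F \in \mathcal{S} } (q-1) \frac{q^{-\operatorname{rk} F}T^{\#F}}{1 - q^{-\operatorname{rk} F}T^{\#F}}, \] and \[ \overline{Z}_M(q,T) = q^{-(\operatorname{rk} M-1)} \sum_{\mathcal{S} \in \mathcal{N}^{\circ}(M,\mathscr{G})} \frac{\overline{\chi}_{M_{\mathcal{S}}}(q)}{(q-1)^{\#\mathcal{S}}} \prod_{F \in \mathcal{S}} (q-1) \frac{q^{-\operatorname{rk} F}T^{\#F}}{1 - q^{-\operatorname{rk} F}T^{\#F}}. \]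
   Context: Let $M$ be a matroid on $E$ with rank function $\operatorname{rk}$ and lattice of flats $\mathcal{L}$; $\chi$, $\overline{\chi}=\chi/(q-1)$ are the (reduced) characteristic polynomials. For $w\in\mathbb{R}^E$: $\operatorname{wt}_M(w)=\max_{B\text{ basis}}\sum_{e\in B}w_e$, $M_w$ has as bases the bases attaining the max, $|w|=\sum_ew_e$; for $v\in\mathbb{R}^E/\mathbb{R}\mathbf{1}$ with lift $w$: $\overline{\operatorname{wt}}_M(v)=\operatorname{wt}_M(w)-(\operatorname{rk}M)\min(w)$, $\overline{|v|}=|w|-(\#E)\min(w)$, $M_v=M_w$. $Z_M(q,T)=\sum_{w\in\mathbb{Z}_{\ge0}^E}\chi_{M_w}(q)q^{-\operatorname{rk}M-\operatorname{wt}_M(w)}T^{|w|}$, $Z_M^0$ is the same sum over $\mathbb{Z}_{>0}^E$, $\overline{Z}_M(q,T)=\sum_{v\in\mathbb{Z}^E/\mathbb{Z}\mathbf{1}}\overline{\chi}_{M_v}(q)q^{-(\operatorname{rk}M-1)-\overline{\operatorname{wt}}_M(v)}T^{\overline{|v|}}$. A building set is $\mathscr{G}\subseteq\mathcal{L}_{>\operatorname{cl}(\emptyset)}$ such that for every $X\in\mathcal{L}_{>\operatorname{cl}(\emptyset)}$, with $\max\mathscr{G}_{\le X}=\{G_1,\dots,G_k\}=:\operatorname{fact}_\mathscr{G}(X)$, there is a poset isomorphism $\prod_i[\operatorname{cl}(\emptyset),G_i]\to[\operatorname{cl}(\emptyset),X]$ sending $(\operatorname{cl}(\emptyset),\dots,G_i,\dots,\operatorname{cl}(\emptyset))$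 to $G_i$. A subset $\mathcal{S}\subseteq\mathscr{G}$ is nested if for any pairwise incomparable $G_1,\dots,G_t\in\mathcal{S}$, $t\ge2$, the join $G_1\vee\dots\vee G_t\notin\mathscr{G}$. $\mathcal{N}(M,\mathscr{G})$ is the set of nested sets, $\mathcal{N}^*(M,\mathscr{G})$ those containing $\operatorname{fact}_\mathscr{G}(E)$, $\mathcal{N}^\circ(M,\mathscr{G})$ the rest. For $\mathcal{S}$ nested, $M_\mathcal{S}=M_w$ for any $w$ in the relative interior of the cone spanned by indicator vectors of the flats in $\mathcal{S}$ (well defined). *)

theory Defs
  imports
    "HOL-Analysis.Analysis"
    "HOL-Computational_Algebra.Formal_Power_Series"
    "HOL-Computational_Algebra.Polynomial_Factorial"
begin

section \<open>Matroids\<close>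

record 'a matroid =
  ground :: "'a set"
  bases :: "'a set set"

definition is_matroid :: "'a matroid \<Rightarrow> bool" where
  "is_matroid M \<longleftrightarrow>
     finite (ground M) \<and>
     bases M \<noteq> {} \<and>
     (\<forall>B\<in>bases M. B \<subseteq> ground M) \<and>
     (\<forall>B1\<in>bases M. \<forall>B2\<in>bases M. \<forall>x\<in>B1 - B2. \<exists>y\<in>B2 - B1. insert y (B1 - {x}) \<in> bases M)"

definition mrank :: "'a matroid \<Rightarrow> 'a set \<Rightarrow> nat" where
  "mrank M A = Max ((\<lambda>B. card (A \<inter> B)) ` bases M)"

abbreviation rk :: "'a matroid \<Rightarrow> nat" where
  "rk M \<equiv> mrank M (ground M)"

definition mcl :: "'a matroid \<Rightarrow> 'a set \<Rightarrow> 'a set" where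
  "mcl M A = {e \<in> ground M. mrank M (insert e A) = mrank M A}"

definition flats :: "'a matroid \<Rightarrow> 'a set set" where
  "flats M = {F. F \<subseteq> ground M \<and> mcl M F = F}"

text \<open>The characteristic polynomial in its Boolean expansion; it vanishes if the matroid has a
  loop. This matters because the initial matroids below may have loops even if \<open>M\<close> has none.\<close>

definition charpoly :: "'a matroid \<Rightarrow> int poly" where
  "charpoly M = (\<Sum>A\<in>Pow (ground M). monom ((- 1) ^ card A) (rk M - mrank M A))"


section \<open>Weights and initial matroids\<close>

text \<open>Weights are used with values in \<open>nat\<close>, \<open>int\<close> and \<open>real\<close>.\<close>

definition wt :: "'a matroid \<Rightarrow> ('a \<Rightarrow> 'b::linordered_semidom) \<Rightarrow> 'b" where
  "wt M w = Max ((\<lambda>B. \<Sum>e\<in>B. w e) ` bases M)"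

definition init_matroid :: "'a matroid \<Rightarrow> ('a \<Rightarrow> 'b::linordered_semidom) \<Rightarrow> 'a matroid" where
  "init_matroid M w = M\<lparr>bases := {B \<in> bases M. (\<Sum>e\<in>B. w e) = wt M w}\<rparr>"

text \<open>For a ground set \<open>E\<close>, elements of \<open>\<int>\<^sup>E\<close> are functions in \<open>E \<rightarrow>\<^sub>E UNIV\<close>, so that each vector
  is represented exactly once. The lattice \<open>\<int>\<^sup>E / \<int>\<one>\<close> is the set of classes of \<open>shift_rel E\<close>.\<close>

definition shift_rel :: "'a set \<Rightarrow> (('a \<Rightarrow> int) \<times> ('a \<Rightarrow> int)) set" where
  "shift_rel E = {(w, w'). w \<in> E \<rightarrow>\<^sub>E UNIV \<and> w' \<in> E \<rightarrow>\<^sub>E UNIV \<and> (\<exists>c. \<forall>e\<in>E. w' e = w e + c)}"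

definition lattice_mod_ones :: "'a set \<Rightarrow> ('a \<Rightarrow> int) set set" where
  "lattice_mod_ones E = (E \<rightarrow>\<^sub>E UNIV) // shift_rel E"

definition lift :: "('a \<Rightarrow> int) set \<Rightarrow> 'a \<Rightarrow> int" where
  "lift v = (SOME w. w \<in> v)"

text \<open>The next three notions do not depend on the lift. The first two use the minimum of a lift
  and are meaningful only for a nonempty ground set.\<close>

definition wt_bar :: "'a matroid \<Rightarrow> ('a \<Rightarrow> int) set \<Rightarrow> int" where
  "wt_bar M v = wt M (lift v) - int (rk M) * Min (lift v ` ground M)"

definition size_bar :: "'a matroid \<Rightarrow> ('a \<Rightarrow> int) set \<Rightarrow> int" where
  "size_bar M v =
     (\<Sum>e\<in>ground M. lift v e) - int (card (ground M)) * Min (lift v ` ground M)"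

definition init_matroid_bar :: "'a matroid \<Rightarrow> ('a \<Rightarrow> int) set \<Rightarrow> 'a matroid" where
  "init_matroid_bar M v = init_matroid M (lift v)"


section \<open>Zeta functions\<close>

text \<open>The zeta functions are formal power series in \<open>T = fps_X\<close> over the field \<open>\<rat>(q)\<close>, realised as
  \<open>int poly fract\<close>. Each coefficient of \<open>T ^ n\<close> is a finite sum; see the lemmas
  \<open>finite_weights\<close> and \<open>finite_classes\<close> below.\<close>

definition qvar :: "int poly fract" where
  "qvar = to_fract [:0, 1:]"

definition chi :: "'a matroid \<Rightarrow> int poly fract" where
  "chi M = to_fract (charpoly M)"

definition chi_bar :: "'a matroid \<Rightarrow> int poly fract" where
  "chi_bar M = chi M / (qvar - 1)"

definition zeta_coeff :: "'a matroid \<Rightarrow> ('a \<Rightarrow> nat) \<Rightarrow> int poly fract" where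
  "zeta_coeff M w = chi (init_matroid M w) * qvar powi (- int (rk M) - int (wt M w))"

definition zeta_coeff_bar :: "'a matroid \<Rightarrow> ('a \<Rightarrow> int) set \<Rightarrow> int poly fract" where
  "zeta_coeff_bar M v =
     chi_bar (init_matroid_bar M v) * qvar powi (- (int (rk M) - 1) - wt_bar M v)"

definition zeta :: "'a matroid \<Rightarrow> int poly fract fps" where
  "zeta M = Abs_fps (\<lambda>n.
     \<Sum>w\<in>{w \<in> ground M \<rightarrow>\<^sub>E UNIV. (\<Sum>e\<in>ground M. w e) = n}. zeta_coeff M w)"

definition zeta0 :: "'a matroid \<Rightarrow> int poly fract fps" where
  "zeta0 M = Abs_fps (\<lambda>n.
     \<Sum>w\<in>{w \<in> ground M \<rightarrow>\<^sub>E {0<..}. (\<Sum>e\<in>ground M. w e) = n}. zeta_coeff M w)"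

definition zeta_bar :: "'a matroid \<Rightarrow> int poly fract fps" where
  "zeta_bar M = Abs_fps (\<lambda>n.
     \<Sum>v\<in>{v \<in> lattice_mod_ones (ground M). size_bar M v = int n}. zeta_coeff_bar M v)"


section \<open>Building sets and nested sets\<close>

definition flat_interval :: "'a matroid \<Rightarrow> 'a set \<Rightarrow> 'a set \<Rightarrow> 'a set set" where
  "flat_interval M X Y = {F \<in> flats M. X \<subseteq> F \<and> F \<subseteq> Y}"

definition fact_set :: "'a set set \<Rightarrow> 'a set \<Rightarrow> 'a set set" where
  "fact_set \<G> X = {G \<in> \<G>. G \<subseteq> X \<and> (\<forall>H\<in>\<G>. H \<subseteq> X \<longrightarrow> G \<subseteq> H \<longrightarrow> H = G)}"

definition building_set :: "'a matroid \<Rightarrow> 'a set set \<Rightarrow> bool" where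
  "building_set M \<G> \<longleftrightarrow>
     \<G> \<subseteq> {F \<in> flats M. mcl M {} \<subset> F} \<and>
     (\<forall>X\<in>flats M. mcl M {} \<subset> X \<longrightarrow>
        (let I = fact_set \<G> X; P = (\<Pi>\<^sub>E G\<in>I. flat_interval M (mcl M {}) G) in
         \<exists>\<phi>. bij_betw \<phi> P (flat_interval M (mcl M {}) X) \<and>
             (\<forall>x\<in>P. \<forall>y\<in>P. (\<forall>G\<in>I. x G \<subseteq> y G) \<longleftrightarrow> \<phi> x \<subseteq> \<phi> y) \<and>
             (\<forall>G\<in>I. \<phi> (\<lambda>H\<in>I. if H = G then G else mcl M {}) = G)))"

text \<open>The join of a family of flats is the closure of its union.\<close>

definition nested :: "'a matroid \<Rightarrow> 'a set set \<Rightarrow> 'a set set \<Rightarrow> bool" where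
  "nested M \<G> \<S> \<longleftrightarrow>
     \<S> \<subseteq> \<G> \<and>
     (\<forall>\<A>\<subseteq>\<S>. card \<A> \<ge> 2 \<and> (\<forall>F\<in>\<A>. \<forall>G\<in>\<A>. F \<noteq> G \<longrightarrow> \<not> F \<subseteq> G \<and> \<not> G \<subseteq> F)
        \<longrightarrow> mcl M (\<Union>\<A>) \<notin> \<G>)"

definition nested_sets :: "'a matroid \<Rightarrow> 'a set set \<Rightarrow> 'a set set set" where
  "nested_sets M \<G> = {\<S>. nested M \<G> \<S>}"

definition nested_sets_star :: "'a matroid \<Rightarrow> 'a set set \<Rightarrow> 'a set set set" where
  "nested_sets_star M \<G> = {\<S> \<in> nested_sets M \<G>. fact_set \<G> (ground M) \<subseteq> \<S>}"

definition nested_sets_circ :: "'a matroid \<Rightarrow> 'a set set \<Rightarrow> 'a set set set" where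
  "nested_sets_circ M \<G> = nested_sets M \<G> - nested_sets_star M \<G>"

text \<open>The ground set is an arbitrary subset of a finite type, and \<open>\<real>\<^sup>E\<close> is identified with a
  coordinate subspace of \<open>real ^ 'a\<close>. This loses no generality, and the cone spanned by indicator
  vectors of subsets of \<open>E\<close> and its relative interior are the same in either space.\<close>

definition indicator_vec :: "'a::finite set \<Rightarrow> real ^ 'a" where
  "indicator_vec F = (\<chi> e. indicator F e)"

definition nested_cone :: "'a::finite set set \<Rightarrow> (real ^ 'a) set" where
  "nested_cone \<S> = convex_cone hull (indicator_vec ` \<S>)"

definition nested_matroid :: "'a::finite matroid \<Rightarrow> 'a set set \<Rightarrow> 'a matroid" where
  "nested_matroid M \<S> =
     init_matroid M (\<lambda>e. (SOME w. w \<in> rel_interior (nested_cone \<S>)) $ e)"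

lemma rel_interior_nested_cone_nonempty: "rel_interior (nested_cone \<S>) \<noteq> {}"
proof -
  have "convex (nested_cone \<S>)" "nested_cone \<S> \<noteq> {}"
    unfolding nested_cone_def
    using convex_cone_convex_cone_hull[of "indicator_vec ` \<S>"] by (simp_all add: convex_cone_def)
  then show ?thesis by (simp add: rel_interior_eq_empty)
qed

text \<open>The monomial \<open>q ^ (- rk F) * T ^ #F\<close>.\<close>

definition flat_monom :: "'a matroid \<Rightarrow> 'a set \<Rightarrow> int poly fract fps" where
  "flat_monom M F = fps_const (qvar powi (- int (mrank M F))) * fps_X ^ card F"


section \<open>Finiteness of the coefficient sums\<close>

lemma finite_weights:
  assumes "finite E"
  shows "finite {w \<in> E \<rightarrow>\<^sub>E (UNIV :: nat set). (\<Sum>e\<in>E. w e) = n}"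
proof (rule finite_subset)
  show "{w \<in> E \<rightarrow>\<^sub>E (UNIV :: nat set). (\<Sum>e\<in>E. w e) = n} \<subseteq> E \<rightarrow>\<^sub>E {..n}"
    using assms by (auto simp: PiE_iff extensional_def intro!: member_le_sum)
  show "finite (E \<rightarrow>\<^sub>E {..n})"
    using assms by (intro finite_PiE) auto
qed

lemma equiv_shift_rel: "equiv (E \<rightarrow>\<^sub>E UNIV) (shift_rel E)"
proof (rule equivI)
  show "shift_rel E \<subseteq> (E \<rightarrow>\<^sub>E UNIV) \<times> (E \<rightarrow>\<^sub>E UNIV)"
    by (auto simp: shift_rel_def)
  show "refl_on (E \<rightarrow>\<^sub>E UNIV) (shift_rel E)"
    by (auto simp: refl_on_def shift_rel_def intro: exI[of _ 0])
  show "sym (shift_rel E)"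
  proof (rule symI)
    fix w w' assume a: "(w, w') \<in> shift_rel E"
    then obtain c where "\<forall>e\<in>E. w' e = w e + c" by (auto simp: shift_rel_def)
    then have "\<forall>e\<in>E. w e = w' e + (- c)" by simp
    with a show "(w', w) \<in> shift_rel E" unfolding shift_rel_def by blast
  qed
  show "trans (shift_rel E)"
  proof (rule transI)
    fix w w' w'' assume a: "(w, w') \<in> shift_rel E" "(w', w'') \<in> shift_rel E"
    then obtain c d where "\<forall>e\<in>E. w' e = w e + c" "\<forall>e\<in>E. w'' e = w' e + d"
      unfolding shift_rel_def by blast
    then have "\<forall>e\<in>E. w'' e = w e + (c + d)" by simp
    with a show "(w, w'') \<in> shift_rel E" unfolding shift_rel_def by blast
  qed
qed

lemma lift_in:
  assumes "v \<in> lattice_mod_ones E"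
  shows "lift v \<in> v" and "lift v \<in> E \<rightarrow>\<^sub>E UNIV" and "v = shift_rel E `` {lift v}"
proof -
  from assms obtain w where w: "w \<in> E \<rightarrow>\<^sub>E UNIV" "v = shift_rel E `` {w}"
    by (auto simp: lattice_mod_ones_def quotient_def)
  then have "w \<in> v" using equiv_class_self[OF equiv_shift_rel] by blast
  then show l: "lift v \<in> v" unfolding lift_def by (rule someI[where P = "\<lambda>w. w \<in> v"])
  then have r: "(w, lift v) \<in> shift_rel E" using w by simp
  then show "lift v \<in> E \<rightarrow>\<^sub>E UNIV" by (auto simp: shift_rel_def)
  show "v = shift_rel E `` {lift v}"
    using equiv_class_eq[OF equiv_shift_rel r] w by simp
qed

lemma finite_classes:
  assumes "finite (ground M)"
  shows "finite {v \<in> lattice_mod_ones (ground M). size_bar M v = int n}"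
proof (rule finite_subset)
  let ?E = "ground M"
  let ?R = "(\<lambda>u. shift_rel ?E `` {u}) ` (?E \<rightarrow>\<^sub>E {0..int n})"
  show "finite ?R" using assms by (intro finite_imageI finite_PiE) auto
  show "{v \<in> lattice_mod_ones ?E. size_bar M v = int n} \<subseteq> ?R"
  proof
    fix v assume "v \<in> {v \<in> lattice_mod_ones ?E. size_bar M v = int n}"
    then have v: "v \<in> lattice_mod_ones ?E" and n: "size_bar M v = int n" by auto
    define m where "m = Min (lift v ` ?E)"
    define u where "u = (\<lambda>e\<in>?E. lift v e - m)"
    have "(lift v, u) \<in> shift_rel ?E"
      unfolding shift_rel_def using lift_in(2)[OF v]
      by (auto simp: u_def intro!: exI[of _ "- m"])
    then have "v = shift_rel ?E `` {u}"
      using lift_in(3)[OF v] equiv_class_eq[OF equiv_shift_rel] by metis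
    moreover have "u \<in> ?E \<rightarrow>\<^sub>E {0..int n}"
    proof -
      have nonneg: "0 \<le> u e" if "e \<in> ?E" for e
        using that assms by (simp add: u_def m_def)
      have s: "(\<Sum>e\<in>?E. u e) = int n"
        using n by (simp add: u_def size_bar_def m_def sum_subtractf)
      have "u e \<le> int n" if "e \<in> ?E" for e
        using member_le_sum[of e ?E u] that assms nonneg s by simp
      with nonneg show ?thesis by (auto simp: u_def PiE_iff)
    qed
    ultimately show "v \<in> ?R" by blast
  qed
qed

end

theory Submission
  imports Defs
begin

text \<open>If \<open>M\<close> has a loop, all terms vanish. Otherwise the initial matroid of \<open>w\<close> has a loop, so that
  its characteristic polynomial vanishes, unless every superlevel set \<open>{w \<ge> k}\<close> is a flat. Peeling
  off superlevel sets and factoring them into members of the building set writes such a \<open>w\<close> in exactly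
  one way as \<open>\<Sum>F\<in>\<S>. c F \<cdot> \<one>\<^sub>F\<close> with \<open>\<S>\<close> nested and all \<open>c F > 0\<close>. A maximal basis for this
  \<open>w\<close> is one that spans every \<open>F \<in> \<S>\<close>, and such bases exist; hence the initial matroid depends only
  on \<open>\<S>\<close>, the weight is \<open>\<Sum>F\<in>\<S>. c F \<cdot> rk F\<close>, and summing over \<open>c\<close> gives a product of geometric
  series. Positive \<open>w\<close> correspond to \<open>\<S>\<close> containing the factors of \<open>E\<close>, and classes modulo \<open>\<one>\<close> to
  weights with minimum \<open>0\<close>, that is, to the remaining nested sets.\<close>

section \<open>Matroid rank and closure\<close>

text \<open>The isomorphism in \<open>building_set\<close> is an abstract order isomorphism that is
  pinned down only on the tuples with one factor and bottoms elsewhere. So it is condensed into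
  three facts about a nonempty flat X: its factors cover it, they are pairwise disjoint, and their
  ranks add up to the rank of X. The first two are found by following atoms through the isomorphism,
  the third by descending one rank at a time. Covering and disjointness say that \<one>_X is the sum
  of the indicator vectors of the factors, so that removing a superlevel set means lowering one
  coefficient per factor. Additivity of rank is the source of a basis that spans all members of a
  nested set at once. It also shows that the factors of the union of a nested set are exactly its
  maximal members, and this is what makes the decomposition of a weight unique.\<close>

definition indep :: "'a matroid \<Rightarrow> 'a set \<Rightarrow> bool" where
  "indep M I \<longleftrightarrow> (\<exists>B\<in>bases M. I \<subseteq> B)"

lemma indep_subset: "indep M J \<Longrightarrow> I \<subseteq> J \<Longrightarrow> indep M I"
  unfolding indep_def by blast

locale matroid =
  fixes M :: "'a matroid"
  assumes matroid: "is_matroid M"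
begin

lemma finite_ground: "finite (ground M)"
  and bases_nonempty: "bases M \<noteq> {}"
  and bases_ground: "B \<in> bases M \<Longrightarrow> B \<subseteq> ground M"
  and exchange: "\<lbrakk>B1 \<in> bases M; B2 \<in> bases M; x \<in> B1 - B2\<rbrakk>
    \<Longrightarrow> \<exists>y\<in>B2 - B1. insert y (B1 - {x}) \<in> bases M"
  using matroid unfolding is_matroid_def by blast+

lemma finite_bases: "finite (bases M)"
  using finite_subset[of "bases M" "Pow (ground M)"] bases_ground finite_ground by blast

lemma finite_basis: "B \<in> bases M \<Longrightarrow> finite B"
  using bases_ground finite_ground finite_subset by blast

lemma indep_finite: "indep M I \<Longrightarrow> finite I"
  unfolding indep_def using finite_basis finite_subset by blast

lemma card_basis_le:
  assumes "B1 \<in> bases M" "B2 \<in> bases M"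
  shows "card B1 \<le> card B2"
  using assms
proof (induction "card (B1 - B2)" arbitrary: B1 rule: less_induct)
  case less
  show ?case
  proof (cases "B1 \<subseteq> B2")
    case True
    then show ?thesis using card_mono finite_basis less.prems by blast
  next
    case False
    then obtain x where x: "x \<in> B1 - B2" by blast
    then obtain y where y: "y \<in> B2 - B1" "insert y (B1 - {x}) \<in> bases M"
      using exchange less.prems by blast
    have "card (insert y (B1 - {x}) - B2) < card (B1 - B2)"
      using x y finite_basis less.prems by (intro psubset_card_mono) auto
    from less.hyps[OF this y(2) less.prems(2)]
    show ?thesis using x y finite_basis[OF less.prems(1)]
      by (simp add: card_insert_if card_Suc_Diff1)
  qed
qed

lemma card_basis_eq: "B1 \<in> bases M \<Longrightarrow> B2 \<in> bases M \<Longrightarrow> card B1 = card B2"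
  using card_basis_le by (simp add: antisym)

text \<open>If no augmentation exists, a basis B2 through J chosen as close as possible to J and a
  basis B1 through I differ only in elements of J - I on the side of B2 and in elements of I - J on
  the side of B1. Both differences have the same size, but J is larger than I.\<close>

lemma augment:
  assumes I: "indep M I" and J: "indep M J" and less: "card I < card J"
  shows "\<exists>e\<in>J - I. indep M (insert e I)"
proof (rule ccontr)
  assume no: "\<not> ?thesis"
  obtain B1 where B1: "B1 \<in> bases M" "I \<subseteq> B1" using I unfolding indep_def by blast
  \<comment> \<open>Minimality outside J and B1 forces B2 into their union: any other element of B2
    could be exchanged for one of B1.\<close>
  obtain B2 where B2: "B2 \<in> bases M" "J \<subseteq> B2"
    and min: "\<And>B. B \<in> bases M \<Longrightarrow> J \<subseteq> B \<Longrightarrow> card (B2 - (J \<union> B1)) \<le> card (B - (J \<union> B1))"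
  proof -
    obtain B where "B \<in> bases M \<and> J \<subseteq> B" using J unfolding indep_def by blast
    from ex_has_least_nat[of "\<lambda>B. B \<in> bases M \<and> J \<subseteq> B", OF this, of "\<lambda>B. card (B - (J \<union> B1))"]
    show thesis using that by auto
  qed
  have JI: "J - B1 = J - I"
    using no B1 unfolding indep_def by blast
  have "B2 - (J \<union> B1) = {}"
  proof (rule ccontr)
    assume "B2 - (J \<union> B1) \<noteq> {}"
    then obtain x where x: "x \<in> B2 - (J \<union> B1)" by blast
    then obtain y where y: "y \<in> B1 - B2" "insert y (B2 - {x}) \<in> bases M"
      using exchange[OF B2(1) B1(1)] by blast
    have "card (insert y (B2 - {x}) - (J \<union> B1)) < card (B2 - (J \<union> B1))"
      using x y finite_basis B2 by (intro psubset_card_mono) auto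
    moreover have "J \<subseteq> insert y (B2 - {x})" using x B2 by blast
    ultimately show False using min[OF y(2)] by simp
  qed
  then have B21: "B2 - B1 = J - I" using B2 JI by blast
  have "B1 - B2 \<subseteq> I - J"
  proof
    fix x assume x: "x \<in> B1 - B2"
    then obtain y where y: "y \<in> B2 - B1" "insert y (B1 - {x}) \<in> bases M"
      using exchange[OF B1(1) B2(1)] by blast
    then have "y \<in> J - I" using B21 by blast
    then have "\<not> insert y I \<subseteq> insert y (B1 - {x})" using no y unfolding indep_def by blast
    then show "x \<in> I - J" using B1 B2 x by blast
  qed
  then have "card (B1 - B2) \<le> card (I - J)"
    using indep_finite[OF I] by (intro card_mono) auto
  moreover have "card (B1 - B2) = card (B2 - B1)"
    using card_basis_eq[OF B1(1) B2(1)] finite_basis[OF B1(1)] finite_basis[OF B2(1)]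
    by (simp add: card_Diff_subset_Int Int_commute)
  moreover have "card (J - I) > card (I - J)"
    using less indep_finite[OF I] indep_finite[OF J]
    by (simp add: card_less_sym_Diff)
  ultimately show False using B21 by simp
qed

lemma card_Int_basis_le: "B \<in> bases M \<Longrightarrow> card (A \<inter> B) \<le> mrank M A"
  unfolding mrank_def using finite_bases by (intro Max_ge) auto

lemma indep_card_le_mrank:
  assumes "indep M I" "I \<subseteq> A" shows "card I \<le> mrank M A"
proof -
  obtain B where B: "B \<in> bases M" "I \<subseteq> B" using assms unfolding indep_def by blast
  then have "card I \<le> card (A \<inter> B)"
    using assms finite_basis by (intro card_mono) auto
  then show ?thesis using card_Int_basis_le[OF B(1)] order_trans by blast
qed

lemma mrank_attained: "\<exists>B\<in>bases M. mrank M A = card (A \<inter> B)"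
proof -
  have "mrank M A \<in> (\<lambda>B. card (A \<inter> B)) ` bases M"
    unfolding mrank_def using finite_bases bases_nonempty by (intro Max_in) auto
  then show ?thesis by blast
qed

lemma indep_extend:
  assumes "indep M I" "I \<subseteq> A"
  shows "\<exists>J. I \<subseteq> J \<and> J \<subseteq> A \<and> indep M J \<and> card J = mrank M A"
  using assms
proof (induction "mrank M A - card I" arbitrary: I rule: less_induct)
  case less
  show ?case
  proof (cases "card I = mrank M A")
    case True
    then show ?thesis using less.prems by blast
  next
    case False
    then have lt: "card I < mrank M A" using indep_card_le_mrank[OF less.prems] by simp
    obtain B where B: "B \<in> bases M" "mrank M A = card (A \<inter> B)" using mrank_attained by blast
    then have "indep M (A \<inter> B)" unfolding indep_def by blast
    then obtain e where e: "e \<in> A \<inter> B - I" "indep M (insert e I)"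
      using augment less.prems lt B by metis
    have "mrank M A - card (insert e I) < mrank M A - card I"
      using lt e indep_finite[OF less.prems(1)] by simp
    from less.hyps[OF this e(2)] show ?thesis using e less.prems by blast
  qed
qed

lemma indep_spanning:
  obtains I where "I \<subseteq> A" "indep M I" "card I = mrank M A"
  using indep_extend[of "{}" A] bases_nonempty unfolding indep_def by auto

lemma mrank_mono: "A \<subseteq> A' \<Longrightarrow> mrank M A \<le> mrank M A'"
proof -
  assume A: "A \<subseteq> A'"
  obtain I where "I \<subseteq> A" "indep M I" "card I = mrank M A" by (rule indep_spanning)
  then show ?thesis using indep_card_le_mrank[of I A'] A by simp
qed

lemma mrank_empty [simp]: "mrank M {} = 0"
  using mrank_attained[of "{}"] by auto

lemma mrank_le_card: "finite A \<Longrightarrow> mrank M A \<le> card A"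
  using mrank_attained[of A] by (auto intro: card_mono)

lemma mrank_Union_le:
  assumes "finite I" shows "mrank M (\<Union>i\<in>I. A i) \<le> (\<Sum>i\<in>I. mrank M (A i))"
proof -
  obtain B where B: "B \<in> bases M" "mrank M (\<Union>i\<in>I. A i) = card ((\<Union>i\<in>I. A i) \<inter> B)"
    using mrank_attained by blast
  have "card ((\<Union>i\<in>I. A i) \<inter> B) = card (\<Union>i\<in>I. A i \<inter> B)" by (rule arg_cong[of _ _ card]) blast
  also have "\<dots> \<le> (\<Sum>i\<in>I. card (A i \<inter> B))" by (rule card_UN_le[OF assms])
  also have "\<dots> \<le> (\<Sum>i\<in>I. mrank M (A i))" by (intro sum_mono card_Int_basis_le B)
  finally show ?thesis using B by simp
qed

text \<open>This is submodularity in local form. If e raised the rank of A', a maximal independent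
  set of A, extended to A' and then to \<open>insert e A'\<close>, would pick up e on the way, and
  its part in \<open>insert e A\<close> would be too large.\<close>

lemma mrank_insert_mono:
  assumes "mrank M (insert e A) = mrank M A" "A \<subseteq> A'"
  shows "mrank M (insert e A') = mrank M A'"
proof (rule ccontr)
  assume neq: "\<not> ?thesis"
  obtain I where I: "I \<subseteq> A" "indep M I" "card I = mrank M A" by (rule indep_spanning)
  obtain J where J: "I \<subseteq> J" "J \<subseteq> A'" "indep M J" "card J = mrank M A'"
    using indep_extend[OF I(2), of A'] I assms by blast
  obtain K where K: "J \<subseteq> K" "K \<subseteq> insert e A'" "indep M K" "card K = mrank M (insert e A')"
    using indep_extend[OF J(3), of "insert e A'"] J by blast
  have "card K > card J" using neq mrank_mono[OF subset_insertI[of A' e]] J K by auto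
  then have "\<not> K \<subseteq> A'" using indep_card_le_mrank[OF K(3), of A'] J(4) by auto
  then have e: "e \<in> K" "e \<notin> A'" using K by blast+
  then have "indep M (insert e I)" using K(1) J(1) by (intro indep_subset[OF K(3)]) auto
  then have "card (insert e I) \<le> mrank M (insert e A)" using I by (intro indep_card_le_mrank) auto
  moreover have "e \<notin> I" using e assms I by blast
  ultimately show False using I assms indep_finite[OF I(2)] by simp
qed

lemma mcl_ground: "mcl M A \<subseteq> ground M"
  unfolding mcl_def by blast

lemma subset_mcl: "A \<subseteq> ground M \<Longrightarrow> A \<subseteq> mcl M A"
  unfolding mcl_def by (auto simp: insert_absorb)

lemma mcl_mono: "A \<subseteq> A' \<Longrightarrow> mcl M A \<subseteq> mcl M A'"
  unfolding mcl_def using mrank_insert_mono by blast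

lemma mrank_mcl:
  assumes "A \<subseteq> ground M" shows "mrank M (mcl M A) = mrank M A"
proof (rule antisym)
  show "mrank M A \<le> mrank M (mcl M A)" by (intro mrank_mono subset_mcl assms)
  obtain I where I: "I \<subseteq> A" "indep M I" "card I = mrank M A" by (rule indep_spanning)
  obtain J where J: "I \<subseteq> J" "J \<subseteq> mcl M A" "indep M J" "card J = mrank M (mcl M A)"
    using indep_extend[OF I(2), of "mcl M A"] I subset_mcl[OF assms] by blast
  have "J \<subseteq> I"
  proof
    fix e assume e: "e \<in> J"
    show "e \<in> I"
    proof (rule ccontr)
      assume "e \<notin> I"
      moreover have "card (insert e I) \<le> mrank M (insert e A)"
        using e J I indep_subset[of M J "insert e I"] by (intro indep_card_le_mrank) auto
      ultimately show False using e J I indep_finite[OF I(2)] unfolding mcl_def by auto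
    qed
  qed
  then show "mrank M (mcl M A) \<le> mrank M A" using I J by auto
qed

lemma mcl_idem:
  assumes "A \<subseteq> ground M" shows "mcl M (mcl M A) = mcl M A"
proof
  show "mcl M A \<subseteq> mcl M (mcl M A)" by (intro subset_mcl mcl_ground)
  show "mcl M (mcl M A) \<subseteq> mcl M A"
  proof
    fix e assume e: "e \<in> mcl M (mcl M A)"
    then have "mrank M (insert e A) \<le> mrank M A"
      using mrank_mono[of "insert e A" "insert e (mcl M A)"] subset_mcl[OF assms] mrank_mcl[OF assms]
      unfolding mcl_def by auto
    then show "e \<in> mcl M A" using e mrank_mono[OF subset_insertI[of A e]] unfolding mcl_def by auto
  qed
qed

lemma mcl_in_flats: "A \<subseteq> ground M \<Longrightarrow> mcl M A \<in> flats M"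
  unfolding flats_def using mcl_idem mcl_ground by blast

lemma flats_ground: "F \<in> flats M \<Longrightarrow> F \<subseteq> ground M"
  and flats_mcl: "F \<in> flats M \<Longrightarrow> mcl M F = F"
  unfolding flats_def by auto

lemma mcl_subset_flat: "A \<subseteq> F \<Longrightarrow> F \<in> flats M \<Longrightarrow> mcl M A \<subseteq> F"
  using mcl_mono flats_mcl by metis

lemma ground_in_flats: "ground M \<in> flats M"
  unfolding flats_def using subset_mcl[of "ground M"] mcl_ground by auto

lemma mrank_flat_less:
  assumes "F \<in> flats M" "F \<subset> G" "G \<subseteq> ground M" shows "mrank M F < mrank M G"
proof -
  obtain e where e: "e \<in> G - F" using assms by blast
  then have "mrank M (insert e F) \<noteq> mrank M F" using assms flats_mcl[of F] unfolding mcl_def by blast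
  then show ?thesis using mrank_mono[OF subset_insertI[of F e]] mrank_mono[of "insert e F" G] e assms by auto
qed

text \<open>Dropping one element from a maximal independent set of F and closing up lowers the rank
  by one. The lemma provides the single downward step for the rank count in
  \<open>fact_structure\<close>.\<close>

lemma flat_predecessor:
  assumes F: "F \<in> flats M" and ne: "mcl M {} \<subset> F"
  obtains F' where "F' \<in> flats M" "F' \<subset> F" "mrank M F \<le> Suc (mrank M F')"
proof -
  obtain I where I: "I \<subseteq> F" "indep M I" "card I = mrank M F" by (rule indep_spanning)
  have "mrank M F > 0"
    using mrank_flat_less[OF mcl_in_flats ne flats_ground[OF F]] by simp
  then obtain x where x: "x \<in> I" using I by fastforce
  have sub: "I - {x} \<subseteq> ground M" using I flats_ground[OF F] by blast
  have rk: "mrank M (mcl M (I - {x})) = card I - 1"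
  proof -
    have "indep M (I - {x})" using I indep_subset by blast
    then have "card (I - {x}) \<le> mrank M (I - {x})" by (intro indep_card_le_mrank) auto
    moreover have "mrank M (I - {x}) \<le> card (I - {x})"
      using indep_finite[OF I(2)] by (intro mrank_le_card) auto
    ultimately show ?thesis using mrank_mcl[OF sub] x by simp
  qed
  show thesis
  proof
    show "mcl M (I - {x}) \<in> flats M" by (rule mcl_in_flats[OF sub])
    have "mcl M (I - {x}) \<subseteq> F" using I F by (intro mcl_subset_flat) auto
    then show "mcl M (I - {x}) \<subset> F" using rk I \<open>mrank M F > 0\<close> by auto
    show "mrank M F \<le> Suc (mrank M (mcl M (I - {x})))" using rk I by simp
  qed
qed

lemma mrank_ground:
  assumes "B \<in> bases M" shows "card B = rk M"
proof -
  obtain B' where "B' \<in> bases M" "rk M = card (ground M \<inter> B')" using mrank_attained by blast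
  then show ?thesis using card_basis_eq[OF assms] bases_ground by (simp add: Int_absorb1)
qed

text \<open>Since e depends on L, the set L together with B - {e} still has full rank, so B - {e}
  can be completed to a basis inside it. The completing element comes from L.\<close>

lemma basis_exchange_mcl:
  assumes B: "B \<in> bases M" and e: "e \<in> B" "e \<in> mcl M L" "e \<notin> L"
  obtains f where "f \<in> L" "f \<notin> B" "insert f (B - {e}) \<in> bases M"
proof -
  define A where "A = L \<union> (B - {e})"
  have "mrank M (insert e L) = mrank M L" using e unfolding mcl_def by blast
  then have "mrank M (insert e A) = mrank M A" by (rule mrank_insert_mono) (auto simp: A_def)
  moreover have "card B \<le> mrank M (insert e A)"
    using B by (intro indep_card_le_mrank) (auto simp: A_def indep_def)
  moreover have "indep M (B - {e})" using B unfolding indep_def by blast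
  ultimately obtain J where J: "B - {e} \<subseteq> J" "J \<subseteq> A" "indep M J" "card J \<ge> card B"
    using indep_extend[of "B - {e}" A] unfolding A_def by auto
  obtain B' where B': "B' \<in> bases M" "J \<subseteq> B'" using J unfolding indep_def by blast
  have "J = B'"
    using B' J card_basis_eq[OF B B'(1)] finite_basis[OF B'(1)] by (simp add: card_seteq)
  have "card (B - {e}) < card J"
    using J e finite_basis[OF B] by (metis card_Diff1_less less_le_trans)
  then have "J \<noteq> B - {e}" by blast
  then obtain f where f: "f \<in> J" "f \<notin> B - {e}" using J by blast
  have fL: "f \<in> L" using f J unfolding A_def by blast
  then have fB: "f \<notin> B" using f e by blast
  have "insert f (B - {e}) \<subseteq> J" using f J by blast
  moreover have "card J \<le> card (insert f (B - {e}))"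
    using card_basis_eq[OF B B'(1)] \<open>J = B'\<close> e fB finite_basis[OF B]
    by (simp add: card_Suc_Diff1)
  ultimately have "insert f (B - {e}) = J"
    using indep_finite[OF J(3)] by (simp add: card_seteq)
  then show thesis using that[OF fL fB] B' \<open>J = B'\<close> by simp
qed

lemma loop_not_in_basis:
  assumes "e \<in> mcl M {}" "B \<in> bases M" shows "e \<notin> B"
  using card_Int_basis_le[OF assms(2), of "{e}"] assms(1) unfolding mcl_def by auto

end

section \<open>Loops, characteristic polynomials and initial matroids\<close>

text \<open>Pairing A with \<open>insert e A\<close> cancels the Boolean expansion: the ranks agree
  and the signs are opposite. No matroid axiom is assumed, so the lemma applies to initial matroids
  without a proof that they are matroids.\<close>

lemma chi_loop:
  assumes fin: "finite (ground M)" and e: "e \<in> ground M" and "\<And>B. B \<in> bases M \<Longrightarrow> e \<notin> B"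
  shows "chi M = 0"
proof -
  have ins: "mrank M (insert e A) = mrank M A" for A
    unfolding mrank_def using assms(3) by (intro arg_cong[of _ _ Max] image_cong) auto
  let ?P = "Pow (ground M - {e})"
  let ?f = "\<lambda>A. monom ((- 1 :: int) ^ card A) (rk M - mrank M A)"
  have P: "Pow (ground M) = ?P \<union> insert e ` ?P"
    using e Pow_insert[of e "ground M - {e}"] by (simp add: insert_absorb)
  have "(\<Sum>A\<in>Pow (ground M). ?f A) = (\<Sum>A\<in>?P. ?f A) + (\<Sum>A\<in>insert e ` ?P. ?f A)"
    unfolding P using fin by (intro sum.union_disjoint) auto
  also have "(\<Sum>A\<in>insert e ` ?P. ?f A) = (\<Sum>A\<in>?P. ?f (insert e A))"
    by (subst sum.reindex) (auto simp: inj_on_def)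
  also have "\<dots> = (\<Sum>A\<in>?P. - ?f A)"
  proof (rule sum.cong[OF refl])
    fix A assume "A \<in> ?P"
    then have "finite A" "e \<notin> A" using fin finite_subset by auto
    then show "?f (insert e A) = - ?f A" by (simp add: ins minus_monom)
  qed
  finally show ?thesis unfolding chi_def charpoly_def by (simp add: sum_negf)
qed

lemma init_matroid_simps [simp]:
  "ground (init_matroid M w) = ground M"
  "bases (init_matroid M w) = {B \<in> bases M. (\<Sum>e\<in>B. w e) = wt M w}"
  unfolding init_matroid_def by simp_all

context matroid
begin

lemma weight_le_wt:
  fixes w :: "'a \<Rightarrow> 'b::linordered_semidom"
  shows "B \<in> bases M \<Longrightarrow> (\<Sum>e\<in>B. w e) \<le> wt M w"
  unfolding wt_def using finite_bases by (intro Max_ge) auto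

lemma wt_eqI:
  fixes w :: "'a \<Rightarrow> 'b::linordered_semidom"
  assumes "B \<in> bases M" "(\<Sum>e\<in>B. w e) = x" "\<And>B. B \<in> bases M \<Longrightarrow> (\<Sum>e\<in>B. w e) \<le> x"
  shows "wt M w = x"
  unfolding wt_def using finite_bases assms by (intro Max_eqI) auto

lemma chi_init_loop:
  assumes "mcl M {} \<noteq> {}" shows "chi (init_matroid M w) = 0"
proof -
  obtain e where e: "e \<in> mcl M {}" using assms by blast
  show ?thesis
    by (rule chi_loop[where e = e]) (use e finite_ground mcl_ground loop_not_in_basis[OF e] in auto)
qed

text \<open>A maximal basis through \<open>e\<close> could be improved by exchanging \<open>e\<close> for an element of the
  superlevel set whose closure contains \<open>e\<close>; hence \<open>e\<close> is a loop of the initial matroid.\<close>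

lemma superlevel_flat:
  fixes w :: "'a \<Rightarrow> 'b::linordered_semidom"
  assumes "chi (init_matroid M w) \<noteq> 0"
  shows "{e \<in> ground M. k \<le> w e} \<in> flats M"
proof (rule ccontr)
  define L where "L = {e \<in> ground M. k \<le> w e}"
  assume "\<not> ?thesis"
  then have "mcl M L \<noteq> L" unfolding flats_def L_def by auto
  then obtain e where e: "e \<in> mcl M L" "e \<notin> L"
    using subset_mcl[of L] unfolding L_def by blast
  have "chi (init_matroid M w) = 0"
  proof (rule chi_loop)
    show "finite (ground (init_matroid M w))" "e \<in> ground (init_matroid M w)"
      using finite_ground e mcl_ground by auto
    fix B assume "B \<in> bases (init_matroid M w)"
    then have B: "B \<in> bases M" "(\<Sum>e\<in>B. w e) = wt M w" by auto
    show "e \<notin> B"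
    proof
      assume eB: "e \<in> B"
      obtain f where f: "f \<in> L" "f \<notin> B" "insert f (B - {e}) \<in> bases M"
        using basis_exchange_mcl[OF B(1) eB e] .
      have "w e < w f" using e f mcl_ground unfolding L_def by fastforce
      then have "(\<Sum>e\<in>B. w e) < (\<Sum>e\<in>insert f (B - {e}). w e)"
        using f finite_basis[OF B(1)] eB by (simp add: sum.remove[of B e])
      then show False using weight_le_wt[OF f(3), of w] B by simp
    qed
  qed
  then show False using assms by simp
qed

end

section \<open>Factors of a flat and nested sets\<close>

definition maximal_sets :: "'a set set \<Rightarrow> 'a set set" where
  "maximal_sets \<S> = {F \<in> \<S>. \<forall>H\<in>\<S>. F \<subseteq> H \<longrightarrow> H = F}"

lemma maximal_sets_above:
  assumes "finite \<S>" "F \<in> \<S>"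
  obtains G where "G \<in> maximal_sets \<S>" "F \<subseteq> G"
proof -
  obtain G where "G \<in> \<S>" "F \<subseteq> G" "\<forall>H\<in>\<S>. G \<subseteq> H \<longrightarrow> G = H"
    using finite_has_maximal2[OF assms] by metis
  then show thesis by (intro that[of G]) (auto simp: maximal_sets_def)
qed

lemma Union_maximal_sets:
  assumes "finite \<S>" shows "\<Union> (maximal_sets \<S>) = \<Union> \<S>"
proof
  show "\<Union> (maximal_sets \<S>) \<subseteq> \<Union> \<S>" by (rule Union_mono) (simp add: maximal_sets_def)
  show "\<Union> \<S> \<subseteq> \<Union> (maximal_sets \<S>)"
  proof (rule Union_least)
    fix F assume "F \<in> \<S>"
    then show "F \<subseteq> \<Union> (maximal_sets \<S>)" by (rule maximal_sets_above[OF assms]) blast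
  qed
qed

lemma nested_subset: "nested M \<G> \<S> \<Longrightarrow> \<S>' \<subseteq> \<S> \<Longrightarrow> nested M \<G> \<S>'"
  unfolding nested_def by (meson order_trans)

lemma nested_join:
  assumes "nested M \<G> \<S>" "\<A> \<subseteq> \<S>" "card \<A> \<ge> 2"
    and "\<And>F G. F \<in> \<A> \<Longrightarrow> G \<in> \<A> \<Longrightarrow> F \<subseteq> G \<Longrightarrow> F = G"
  shows "mcl M (\<Union>\<A>) \<notin> \<G>"
proof -
  have "\<forall>F\<in>\<A>. \<forall>G\<in>\<A>. F \<noteq> G \<longrightarrow> \<not> F \<subseteq> G \<and> \<not> G \<subseteq> F" using assms(4) by metis
  then show ?thesis using assms(1-3) unfolding nested_def by simp
qed

text \<open>Without loops the least flat is the empty set, so bottom elements of intervals are empty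
  and members of the building set are nonempty.\<close>

locale loopless_building = matroid +
  fixes \<G> :: "'a set set"
  assumes building: "building_set M \<G>" and loopless: "mcl M {} = {}"
begin

lemma building_flat: "G \<in> \<G> \<Longrightarrow> G \<in> flats M" and building_nonempty: "G \<in> \<G> \<Longrightarrow> G \<noteq> {}"
  using building loopless unfolding building_set_def by auto

lemma building_ground: "G \<in> \<G> \<Longrightarrow> G \<subseteq> ground M"
  using building_flat flats_ground by blast

lemma finite_building: "finite \<G>"
  using finite_subset[of \<G> "Pow (ground M)"] building_ground finite_ground by blast

lemma empty_flat: "{} \<in> flats M"
  using loopless by (simp add: flats_def)

lemma fact_subset: "fact_set \<G> X \<subseteq> \<G>"
  unfolding fact_set_def by blast

lemma fact_above:
  assumes "H \<in> \<G>" "H \<subseteq> X"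
  obtains G where "G \<in> fact_set \<G> X" "H \<subseteq> G"
proof -
  have "fact_set \<G> X = maximal_sets {G \<in> \<G>. G \<subseteq> X}"
    unfolding fact_set_def maximal_sets_def by blast
  then show thesis using maximal_sets_above[of "{G \<in> \<G>. G \<subseteq> X}" H] that assms finite_building by auto
qed

lemma fact_maximal: "G \<in> fact_set \<G> X \<Longrightarrow> H \<in> \<G> \<Longrightarrow> G \<subseteq> H \<Longrightarrow> H \<subseteq> X \<Longrightarrow> H = G"
  unfolding fact_set_def by blast

text \<open>The closure of a single element has rank at most 1, so a flat strictly below it has rank
  0 and is empty. In the covering argument this identifies the image of a one-coordinate
  tuple.\<close>

lemma atom_flat:
  assumes "F \<in> flats M" "F \<noteq> {}" "F \<subseteq> mcl M {e}" "e \<in> ground M" shows "F = mcl M {e}"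
proof (rule ccontr)
  assume "F \<noteq> mcl M {e}"
  then have "mrank M F < mrank M (mcl M {e})"
    using assms mcl_ground by (intro mrank_flat_less) auto
  also have "\<dots> \<le> 1" using mrank_mcl[of "{e}"] mrank_le_card[of "{e}"] assms by simp
  finally have "mrank M F = 0" by simp
  then have "\<not> {} \<subset> F"
    using mrank_flat_less[OF empty_flat, of F] assms(1) flats_ground by auto
  then show False using assms by blast
qed

text \<open>Each atom cl{e} is the image of a tuple t. A nonempty coordinate of t locates e in a
  factor, and e cannot lie in two factors because t would then be empty in every coordinate. For the
  ranks, lowering one coordinate to a predecessor costs at most 1 on the side of the tuple and at
  least 1 on the side of its image.\<close>

lemma fact_structure:
  assumes X: "X \<in> flats M" and ne: "X \<noteq> {}"
  shows fact_cover: "X \<subseteq> \<Union> (fact_set \<G> X)"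
    and fact_disjoint: "\<lbrakk>G \<in> fact_set \<G> X; H \<in> fact_set \<G> X; e \<in> G; e \<in> H\<rbrakk> \<Longrightarrow> G = H"
    and fact_rank: "(\<Sum>G\<in>fact_set \<G> X. mrank M G) \<le> mrank M X"
proof -
  define I where "I = fact_set \<G> X"
  define P where "P = (\<Pi>\<^sub>E G\<in>I. flat_interval M {} G)"
  define single where "single G b = (\<lambda>H\<in>I. if H = G then b else {})" for G b :: "'a set"
  have "{} \<subset> X" using ne by blast
  then have "\<exists>\<phi>. bij_betw \<phi> P (flat_interval M {} X) \<and>
      (\<forall>x\<in>P. \<forall>y\<in>P. (\<forall>G\<in>I. x G \<subseteq> y G) \<longleftrightarrow> \<phi> x \<subseteq> \<phi> y) \<and> (\<forall>G\<in>I. \<phi> (single G G) = G)"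
    using building X unfolding building_set_def loopless Let_def I_def P_def single_def by simp
  then obtain \<phi> where bij: "bij_betw \<phi> P (flat_interval M {} X)"
    and iso: "\<forall>x\<in>P. \<forall>y\<in>P. (\<forall>G\<in>I. x G \<subseteq> y G) \<longleftrightarrow> \<phi> x \<subseteq> \<phi> y"
    and gen: "\<forall>G\<in>I. \<phi> (single G G) = G"
    by (elim exE conjE)
  have ord: "(\<forall>G\<in>I. x G \<subseteq> y G) \<longleftrightarrow> \<phi> x \<subseteq> \<phi> y" if "x \<in> P" "y \<in> P" for x y
    using iso that by simp
  have IG: "G \<in> \<G>" "G \<subseteq> X" if "G \<in> I" for G using that unfolding I_def fact_set_def by auto
  have finI: "finite I" using fact_subset finite_building finite_subset unfolding I_def by blast
  have flat: "\<phi> t \<in> flats M" "\<phi> t \<subseteq> X" if "t \<in> P" for t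
    using bij_betwE[OF bij] that unfolding flat_interval_def by auto
  have P_flat: "t G \<in> flats M" "t G \<subseteq> G" if "t \<in> P" "G \<in> I" for t G
    using that unfolding P_def flat_interval_def by auto
  have singleP: "single G b \<in> P" if "b \<in> flats M" "b \<subseteq> G" for G b
    using that empty_flat unfolding P_def single_def flat_interval_def by auto
  have atom: "\<exists>t\<in>P. \<phi> t = mcl M {e} \<and> (\<exists>G\<in>I. t G \<noteq> {})" if e: "e \<in> X" for e
  proof -
    have eg: "e \<in> ground M" using e X flats_ground by blast
    have "mcl M {e} \<in> flat_interval M {} X"
      using e X eg mcl_in_flats[of "{e}"] mcl_subset_flat[of "{e}" X] unfolding flat_interval_def by auto
    then obtain t where t: "t \<in> P" "\<phi> t = mcl M {e}"
      using bij_betw_imp_surj_on[OF bij] by (metis imageE)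
    have "\<exists>G\<in>I. t G \<noteq> {}"
    proof (rule ccontr)
      assume none: "\<not> ?thesis"
      have "{} \<in> flat_interval M {} X" using empty_flat by (simp add: flat_interval_def)
      then obtain b where b: "b \<in> P" "\<phi> b = {}"
        using bij_betw_imp_surj_on[OF bij] by (metis imageE)
      have "\<phi> t \<subseteq> \<phi> b" using ord[OF t(1) b(1)] none by auto
      then show False using b t subset_mcl[of "{e}"] eg by auto
    qed
    then show ?thesis using t by blast
  qed
  show "X \<subseteq> \<Union> (fact_set \<G> X)"
  proof
    fix e assume e: "e \<in> X"
    then have eg: "e \<in> ground M" using X flats_ground by blast
    obtain t G where t: "t \<in> P" "\<phi> t = mcl M {e}" "G \<in> I" "t G \<noteq> {}" using atom[OF e] by blast
    \<comment> \<open>Only the coordinate G of t is kept. The image of s is a nonempty flat below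
      the atom cl{e}, hence equal to it, and it also lies below the image of
      \<open>single G G\<close>, which is G.\<close>
    define s where "s = single G (t G)"
    have s: "s \<in> P" using P_flat[OF t(1,3)] unfolding s_def by (intro singleP)
    have GP: "single G G \<in> P" using singleP IG(1)[OF t(3)] building_flat by blast
    have "\<forall>K\<in>I. s K \<subseteq> t K" by (simp add: s_def single_def)
    then have "\<phi> s \<subseteq> \<phi> t" using ord[OF s t(1)] by simp
    moreover have "\<phi> s \<noteq> {}"
    proof
      assume "\<phi> s = {}"
      moreover have "single G {} \<in> P" by (intro singleP empty_flat) auto
      ultimately have "\<forall>H\<in>I. s H \<subseteq> single G {} H" using ord[OF s] by auto
      then show False using t by (auto simp: s_def single_def)
    qed
    ultimately have "\<phi> s = mcl M {e}" using atom_flat[of "\<phi> s" e] flat(1)[OF s] t(2) eg by simp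
    moreover have "\<forall>K\<in>I. s K \<subseteq> single G G K"
      using P_flat(2)[OF t(1,3)] by (simp add: s_def single_def)
    then have "\<phi> s \<subseteq> \<phi> (single G G)" using ord[OF s GP] by simp
    ultimately show "e \<in> \<Union> (fact_set \<G> X)"
      using bspec[OF gen t(3)] t(3) subset_mcl[of "{e}"] eg unfolding I_def by auto
  qed
  show "G = H" if G: "G \<in> fact_set \<G> X" and H: "H \<in> fact_set \<G> X" and e: "e \<in> G" "e \<in> H" for G H e
  proof (rule ccontr)
    assume GH: "G \<noteq> H"
    have GI: "G \<in> I" "H \<in> I" using G H unfolding I_def by auto
    obtain t K where t: "t \<in> P" "\<phi> t = mcl M {e}" "K \<in> I" "t K \<noteq> {}"
      using atom[OF subsetD[OF IG(2)[OF GI(1)] e(1)]] by blast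
    have "\<forall>K\<in>I. t K \<subseteq> single G' G' K" if "G' \<in> I" "e \<in> G'" for G'
    proof -
      have "mcl M {e} \<subseteq> G'" using that IG building_flat by (intro mcl_subset_flat) auto
      moreover have "single G' G' \<in> P" using that IG building_flat by (intro singleP) auto
      ultimately show ?thesis using ord[OF t(1)] t(2) bspec[OF gen that(1)] by simp
    qed
    \<comment> \<open>The two bounds make t empty away from G and away from H, while its coordinate
      K is nonempty.\<close>
    from this[OF GI(1) e(1)] this[OF GI(2) e(2)] show False
      using t(3,4) GH unfolding single_def by (auto split: if_splits)
  qed
  \<comment> \<open>The claim for all tuples is what the induction needs; the rank bound is its
    instance at the top tuple, whose coordinate at G is G itself.\<close>
  have "(\<Sum>G\<in>I. mrank M (t G)) \<le> mrank M (\<phi> t)" if "t \<in> P" for t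
    using that
  proof (induction "card (\<phi> t)" arbitrary: t rule: less_induct)
    case less
    show ?case
    proof (cases "\<forall>G\<in>I. t G = {}")
      case True
      then show ?thesis by simp
    next
      case False
      then obtain G where G: "G \<in> I" "t G \<noteq> {}" by blast
      then have "mcl M {} \<subset> t G" using loopless by auto
      then obtain F where F: "F \<in> flats M" "F \<subset> t G" "mrank M (t G) \<le> Suc (mrank M F)"
        using flat_predecessor P_flat(1)[OF less.prems G(1)] by blast
      have tF: "t(G := F) \<in> P"
        using less.prems G F P_flat(2)[OF less.prems G(1)]
        unfolding P_def by (auto simp: flat_interval_def PiE_iff extensional_def)
      have "\<forall>H\<in>I. (t(G := F)) H \<subseteq> t H" using psubset_imp_subset[OF F(2)] by simp
      then have "\<phi> (t(G := F)) \<subseteq> \<phi> t" using ord[OF tF less.prems] by simp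
      moreover have "\<not> (\<forall>H\<in>I. t H \<subseteq> (t(G := F)) H)" using F(2) G(1) by (metis fun_upd_same leD)
      then have "\<not> \<phi> t \<subseteq> \<phi> (t(G := F))" by (simp only: ord[OF less.prems tF] not_False_eq_True)
      ultimately have lt: "\<phi> (t(G := F)) \<subset> \<phi> t" by blast
      have gr: "\<phi> t \<subseteq> ground M" using flat(1)[OF less.prems] flats_ground by blast
      have "card (\<phi> (t(G := F))) < card (\<phi> t)"
        using lt gr finite_ground finite_subset psubset_card_mono by metis
      from less.hyps[OF this tF]
      have "(\<Sum>H\<in>I. mrank M ((t(G := F)) H)) \<le> mrank M (\<phi> (t(G := F)))" .
      moreover have "mrank M (\<phi> (t(G := F))) < mrank M (\<phi> t)"
        by (rule mrank_flat_less[OF flat(1)[OF tF] lt gr])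
      moreover have "(\<Sum>H\<in>I. mrank M ((t(G := F)) H)) = mrank M F + (\<Sum>H\<in>I - {G}. mrank M (t H))"
        using sum.remove[OF finI G(1), of "\<lambda>H. mrank M ((t(G := F)) H)"] by simp
      moreover have "(\<Sum>H\<in>I. mrank M (t H)) = mrank M (t G) + (\<Sum>H\<in>I - {G}. mrank M (t H))"
        by (rule sum.remove[OF finI G(1)])
      ultimately show ?thesis using F(3) by linarith
    qed
  qed
  from this[of "\<lambda>G\<in>I. G"] have top: "(\<Sum>G\<in>I. mrank M G) \<le> mrank M (\<phi> (\<lambda>G\<in>I. G))"
    if "(\<lambda>G\<in>I. G) \<in> P" using that by simp
  have "(\<lambda>G\<in>I. G) \<in> P" using IG building_flat unfolding P_def flat_interval_def by auto
  then show "(\<Sum>G\<in>fact_set \<G> X. mrank M G) \<le> mrank M X"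
    using top flat(2) mrank_mono order_trans unfolding I_def[symmetric] by meson
qed

lemma fact_empty: "fact_set \<G> {} = {}"
  using building_nonempty unfolding fact_set_def by blast

lemma Union_fact: "X \<in> flats M \<Longrightarrow> \<Union> (fact_set \<G> X) = X"
  using fact_cover[of X] unfolding fact_set_def by blast

lemma fact_unique:
  assumes "X \<in> flats M" "G \<in> fact_set \<G> X" "H \<in> fact_set \<G> X" "e \<in> G" "e \<in> H"
  shows "G = H"
  using fact_disjoint[OF assms(1)] assms fact_empty by blast

lemma sum_mrank_fact:
  assumes "X \<in> flats M" shows "(\<Sum>G\<in>fact_set \<G> X. mrank M G) = mrank M X"
proof (rule antisym)
  show "(\<Sum>G\<in>fact_set \<G> X. mrank M G) \<le> mrank M X"
    using fact_rank[OF assms] fact_empty by (cases "X = {}") auto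
  have "finite (fact_set \<G> X)" using finite_subset[OF fact_subset finite_building] .
  from mrank_Union_le[OF this, of "\<lambda>G. G"]
  show "mrank M X \<le> (\<Sum>G\<in>fact_set \<G> X. mrank M G)" using Union_fact[OF assms] by simp
qed

text \<open>Rank additivity forces each factor \<open>G\<close> of the join to be the join of the members of \<open>\<A>\<close> below
  it, and since \<open>G\<close> lies in the building set there can be only one such member.\<close>

lemma fact_join_antichain:
  assumes A: "\<A> \<subseteq> \<G>" and join: "\<And>\<B>. \<B> \<subseteq> \<A> \<Longrightarrow> card \<B> \<ge> 2 \<Longrightarrow> mcl M (\<Union>\<B>) \<notin> \<G>"
  shows "fact_set \<G> (mcl M (\<Union>\<A>)) = \<A>"
proof -
  define X where "X = mcl M (\<Union>\<A>)"
  define I where "I = fact_set \<G> X"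
  define below where "below G = {F \<in> \<A>. F \<subseteq> G}" for G
  have Ag: "\<Union>\<A> \<subseteq> ground M" using A building_ground by blast
  have X: "X \<in> flats M" unfolding X_def by (rule mcl_in_flats[OF Ag])
  have finI: "finite I" unfolding I_def by (rule finite_subset[OF fact_subset finite_building])
  have below_ground: "\<Union> (below G) \<subseteq> ground M" for G using Ag unfolding below_def by blast
  have IG: "G \<in> \<G>" "G \<in> flats M" "G \<subseteq> ground M" if "G \<in> I" for G
    using that fact_subset building_flat building_ground unfolding I_def by blast+
  have above: "\<exists>G\<in>I. F \<subseteq> G" if "F \<in> \<A>" for F
  proof (rule fact_above[of F X])
    show "F \<in> \<G>" "F \<subseteq> X" using that A subset_mcl[OF Ag] unfolding X_def by auto
  qed (auto simp: I_def)
  have le: "mrank M (\<Union> (below G)) \<le> mrank M G" for G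
    by (rule mrank_mono) (auto simp: below_def)
  have "(\<Sum>G\<in>I. mrank M G) = mrank M (\<Union>\<A>)"
    using sum_mrank_fact[OF X] mrank_mcl[OF Ag] unfolding I_def X_def by simp
  also have "\<dots> \<le> mrank M (\<Union>G\<in>I. \<Union> (below G))"
  proof (intro mrank_mono Union_least)
    fix F assume F: "F \<in> \<A>"
    obtain G where "G \<in> I" "F \<subseteq> G" using above[OF F] by (elim bexE)
    then show "F \<subseteq> (\<Union>G\<in>I. \<Union> (below G))" using F by (auto simp: below_def)
  qed
  also have "\<dots> \<le> (\<Sum>G\<in>I. mrank M (\<Union> (below G)))" by (rule mrank_Union_le[OF finI])
  finally have ge: "(\<Sum>G\<in>I. mrank M G) \<le> (\<Sum>G\<in>I. mrank M (\<Union> (below G)))" .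
  have eq: "mrank M (\<Union> (below G)) = mrank M G" if "G \<in> I" for G
  proof (rule ccontr)
    assume "mrank M (\<Union> (below G)) \<noteq> mrank M G"
    then have "mrank M (\<Union> (below G)) < mrank M G" using le[of G] by simp
    then have "(\<Sum>G\<in>I. mrank M (\<Union> (below G))) < (\<Sum>G\<in>I. mrank M G)"
      using le that finI by (intro sum_strict_mono_ex1) auto
    then show False using ge by simp
  qed
  have single: "below G = {G}" if G: "G \<in> I" for G
  proof -
    have "mcl M (\<Union> (below G)) \<subseteq> G" using IG[OF G] by (intro mcl_subset_flat) (auto simp: below_def)
    then have cl: "mcl M (\<Union> (below G)) = G"
      using mrank_flat_less[OF mcl_in_flats[OF below_ground[of G]], of G] mrank_mcl[OF below_ground[of G]]
        eq[OF G] IG[OF G] by auto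
    \<comment> \<open>If no member were below G, then G would be the closure of the empty set, which
      is empty. Two or more members would have the join G inside the building set.\<close>
    then have "below G \<noteq> {}" using loopless building_nonempty[OF IG(1)[OF G]] by auto
    moreover have "\<not> 2 \<le> card (below G)" using join[of "below G"] cl IG[OF G] unfolding below_def by auto
    moreover have "finite (below G)" using finite_subset[OF A finite_building] unfolding below_def by simp
    ultimately have "card (below G) = 1" using card_gt_0_iff[of "below G"] by linarith
    then obtain F where F: "below G = {F}" by (rule card_1_singletonE)
    then have "F \<in> \<A>" unfolding below_def by blast
    then have "F = G" using cl F flats_mcl[of F] A building_flat by auto
    then show ?thesis using F by simp
  qed
  have "I = \<A>"
  proof
    show "I \<subseteq> \<A>" using single unfolding below_def by blast
    show "\<A> \<subseteq> I"
    proof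
      fix F assume F: "F \<in> \<A>"
      then obtain G where G: "G \<in> I" "F \<subseteq> G" using above by blast
      then have "F \<in> below G" using F unfolding below_def by blast
      then show "F \<in> I" using single[OF G(1)] G by simp
    qed
  qed
  then show ?thesis unfolding I_def X_def .
qed

lemma nested_finite: "nested M \<G> \<S> \<Longrightarrow> finite \<S>"
  and nested_building: "nested M \<G> \<S> \<Longrightarrow> \<S> \<subseteq> \<G>"
  using finite_building finite_subset unfolding nested_def by auto

lemma nested_empty: "nested M \<G> {}"
  unfolding nested_def by auto

text \<open>The maximal members form an antichain all of whose subfamilies of size at least 2 have
  joins outside the building set, so they are the factors of their join. Factors cover, hence the
  join is the plain union, and the union of a nested set is already closed.\<close>

lemma nested_maximal:
  assumes S: "nested M \<G> \<S>"
  shows Union_nested_flat: "\<Union>\<S> \<in> flats M" and fact_Union_nested: "fact_set \<G> (\<Union>\<S>) = maximal_sets \<S>"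
proof -
  have sub: "maximal_sets \<S> \<subseteq> \<S>" unfolding maximal_sets_def by blast
  have fact: "fact_set \<G> (mcl M (\<Union> (maximal_sets \<S>))) = maximal_sets \<S>"
  proof (rule fact_join_antichain)
    show "maximal_sets \<S> \<subseteq> \<G>" using sub nested_building[OF S] by blast
    fix \<B> assume B: "\<B> \<subseteq> maximal_sets \<S>" "card \<B> \<ge> 2"
    show "mcl M (\<Union>\<B>) \<notin> \<G>"
    proof (rule nested_join[OF S])
      show "\<B> \<subseteq> \<S>" "card \<B> \<ge> 2" using B sub by auto
      fix F G assume "F \<in> \<B>" "G \<in> \<B>" "F \<subseteq> G"
      moreover from this have "F \<in> maximal_sets \<S>" "G \<in> \<S>" using B(1) sub by auto
      ultimately show "F = G" unfolding maximal_sets_def by blast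
    qed
  qed
  have un: "\<Union> (maximal_sets \<S>) = \<Union>\<S>" by (rule Union_maximal_sets[OF nested_finite[OF S]])
  have fl: "mcl M (\<Union>\<S>) \<in> flats M"
    using nested_building[OF S] building_ground by (intro mcl_in_flats) blast
  have "mcl M (\<Union>\<S>) = \<Union>\<S>" using Union_fact[OF fl] fact un by simp
  then show "\<Union>\<S> \<in> flats M" "fact_set \<G> (\<Union>\<S>) = maximal_sets \<S>" using fl fact un by simp_all
qed

text \<open>The maximal members are stripped off, and an independent set for the remaining ones is
  extended to a spanning set K of the union. Members below keep their full intersection because K
  only grows; for the maximal ones equality is forced by counting.\<close>

lemma nested_indep:
  "nested M \<G> \<S> \<Longrightarrow> \<exists>J\<subseteq>\<Union>\<S>. indep M J \<and> (\<forall>F\<in>\<S>. card (F \<inter> J) = mrank M F)"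
proof (induction "card \<S>" arbitrary: \<S> rule: less_induct)
  case less
  define X where "X = \<Union>\<S>"
  show ?case
  proof (cases "\<S> = {}")
    case True
    then show ?thesis using bases_nonempty unfolding indep_def by auto
  next
    case False
    define T where "T = \<S> - maximal_sets \<S>"
    have fin: "finite \<S>" by (rule nested_finite[OF less.prems])
    have "maximal_sets \<S> \<noteq> {}" using False maximal_sets_above[OF fin] by (metis all_not_in_conv)
    then have "card T < card \<S>"
      using fin unfolding T_def maximal_sets_def by (intro psubset_card_mono) auto
    moreover have "nested M \<G> T" using nested_subset[OF less.prems] unfolding T_def by blast
    ultimately obtain J where J: "J \<subseteq> \<Union>T" "indep M J" "\<forall>F\<in>T. card (F \<inter> J) = mrank M F"
      using less.hyps by blast
    have "J \<subseteq> X" using J(1) unfolding X_def T_def by blast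
    then obtain K where K: "J \<subseteq> K" "K \<subseteq> X" "indep M K" "card K = mrank M X"
      using indep_extend[OF J(2)] by blast
    have finK: "finite K" by (rule indep_finite[OF K(3)])
    have le: "card (F \<inter> K) \<le> mrank M F" for F
      using indep_subset[OF K(3)] by (intro indep_card_le_mrank) auto
    have Xf: "X \<in> flats M" and fact: "fact_set \<G> X = maximal_sets \<S>"
      using nested_maximal[OF less.prems] unfolding X_def by auto
    have finM: "finite (maximal_sets \<S>)" using fin unfolding maximal_sets_def by simp
    have "K = (\<Union>F\<in>maximal_sets \<S>. F \<inter> K)"
      using K(2) Union_maximal_sets[OF fin] unfolding X_def by blast
    then have "card K = card (\<Union>F\<in>maximal_sets \<S>. F \<inter> K)" by simp
    also have "\<dots> \<le> (\<Sum>F\<in>maximal_sets \<S>. card (F \<inter> K))" by (rule card_UN_le[OF finM])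
    \<comment> \<open>The ranks of the factors add up to the size of K, and K meets each factor in
      at most its rank, so no factor can fall short.\<close>
    finally have ge: "(\<Sum>F\<in>maximal_sets \<S>. mrank M F) \<le> (\<Sum>F\<in>maximal_sets \<S>. card (F \<inter> K))"
      using K(4) sum_mrank_fact[OF Xf] fact by simp
    have "card (F \<inter> K) = mrank M F" if F: "F \<in> \<S>" for F
    proof (cases "F \<in> maximal_sets \<S>")
      case True
      show ?thesis
      proof (rule ccontr)
        assume "card (F \<inter> K) \<noteq> mrank M F"
        then have "card (F \<inter> K) < mrank M F" using le[of F] by simp
        then have "(\<Sum>F\<in>maximal_sets \<S>. card (F \<inter> K)) < (\<Sum>F\<in>maximal_sets \<S>. mrank M F)"
          using le True finM by (intro sum_strict_mono_ex1) auto
        then show False using ge by simp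
      qed
    next
      case False
      then have "card (F \<inter> J) = mrank M F" using J(3) F unfolding T_def by blast
      moreover have "card (F \<inter> J) \<le> card (F \<inter> K)" using K(1) finK by (intro card_mono) auto
      ultimately show ?thesis using le[of F] by simp
    qed
    then show ?thesis using K unfolding X_def by blast
  qed
qed

lemma nested_basis:
  assumes "nested M \<G> \<S>"
  shows "\<exists>B\<in>bases M. \<forall>F\<in>\<S>. card (F \<inter> B) = mrank M F"
proof -
  obtain J where J: "indep M J" "\<forall>F\<in>\<S>. card (F \<inter> J) = mrank M F" using nested_indep[OF assms] by blast
  then obtain B where B: "B \<in> bases M" "J \<subseteq> B" unfolding indep_def by blast
  have "card (F \<inter> B) = mrank M F" if "F \<in> \<S>" for F
  proof (rule antisym)
    show "card (F \<inter> B) \<le> mrank M F" by (rule card_Int_basis_le[OF B(1)])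
    have "card (F \<inter> J) \<le> card (F \<inter> B)" using B finite_basis by (intro card_mono) auto
    then show "mrank M F \<le> card (F \<inter> B)" using J(2) that by simp
  qed
  then show ?thesis using B by blast
qed

end

section \<open>Generating functions of weighted sets\<close>

text \<open>A sum over an infinite fibre would silently be 0, so finiteness of the fibres is carried
  along as \<open>finite_fibers\<close> wherever sums are split or restricted.\<close>

definition gen_fps :: "'i set \<Rightarrow> ('i \<Rightarrow> 'c::comm_monoid_add) \<Rightarrow> ('i \<Rightarrow> nat) \<Rightarrow> 'c fps" where
  "gen_fps W f s = Abs_fps (\<lambda>n. \<Sum>w\<in>{w \<in> W. s w = n}. f w)"

definition finite_fibers :: "'i set \<Rightarrow> ('i \<Rightarrow> nat) \<Rightarrow> bool" where
  "finite_fibers W s \<longleftrightarrow> (\<forall>n. finite {w \<in> W. s w = n})"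

lemma gen_fps_nth: "fps_nth (gen_fps W f s) n = (\<Sum>w\<in>{w \<in> W. s w = n}. f w)"
  unfolding gen_fps_def by simp

lemma gen_fps_cong:
  assumes "\<And>w. w \<in> W \<Longrightarrow> f w = g w" "\<And>w. w \<in> W \<Longrightarrow> s w = t w"
  shows "gen_fps W f s = gen_fps W g t"
proof (rule fps_ext)
  fix n
  have "{w \<in> W. s w = n} = {w \<in> W. t w = n}" using assms(2) by auto
  then show "fps_nth (gen_fps W f s) n = fps_nth (gen_fps W g t) n"
    using assms(1) by (auto simp: gen_fps_nth intro: sum.cong)
qed

lemma gen_fps_reindex:
  assumes "inj_on h V"
  shows "gen_fps (h ` V) f s = gen_fps V (\<lambda>v. f (h v)) (\<lambda>v. s (h v))"
proof (rule fps_ext)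
  fix n
  have eq: "{w \<in> h ` V. s w = n} = h ` {v \<in> V. s (h v) = n}" by auto
  have "inj_on h {v \<in> V. s (h v) = n}" using assms by (rule inj_on_subset) auto
  then show "fps_nth (gen_fps (h ` V) f s) n = fps_nth (gen_fps V (\<lambda>v. f (h v)) (\<lambda>v. s (h v))) n"
    unfolding gen_fps_nth eq by (simp add: sum.reindex)
qed

lemma gen_fps_mono_neutral:
  assumes "finite_fibers W s" "V \<subseteq> W" "\<And>w. w \<in> W - V \<Longrightarrow> f w = 0"
  shows "gen_fps W f s = gen_fps V f s"
proof (rule fps_ext)
  fix n
  show "fps_nth (gen_fps W f s) n = fps_nth (gen_fps V f s) n"
    unfolding gen_fps_nth
    by (rule sum.mono_neutral_right) (use assms in \<open>auto simp: finite_fibers_def\<close>)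
qed

lemma gen_fps_cmult:
  fixes f :: "'i \<Rightarrow> 'c::comm_ring_1"
  shows "gen_fps W (\<lambda>w. a * f w) s = fps_const a * gen_fps W f s"
  by (rule fps_ext) (simp add: gen_fps_nth sum_distrib_left)

lemma gen_fps_Sigma:
  assumes "finite I" "\<And>i. i \<in> I \<Longrightarrow> finite_fibers (W i) (s i)"
  shows "gen_fps (Sigma I W) (\<lambda>(i, w). f i w) (\<lambda>(i, w). s i w) = (\<Sum>i\<in>I. gen_fps (W i) (f i) (s i))"
proof (rule fps_ext)
  fix n
  have eq: "{p \<in> Sigma I W. (case p of (i, w) \<Rightarrow> s i w) = n} = Sigma I (\<lambda>i. {w \<in> W i. s i w = n})"
    by auto
  show "fps_nth (gen_fps (Sigma I W) (\<lambda>(i, w). f i w) (\<lambda>(i, w). s i w)) n =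
        fps_nth (\<Sum>i\<in>I. gen_fps (W i) (f i) (s i)) n"
    unfolding gen_fps_nth eq fps_sum_nth
    using assms by (subst sum.Sigma) (auto simp: finite_fibers_def)
qed

lemma fiber_Times:
  fixes s :: "'i \<Rightarrow> nat"
  shows "{p \<in> W \<times> V. (case p of (w, v) \<Rightarrow> s w + t v) = n} =
    (\<Union>i\<in>{0..n}. {w \<in> W. s w = i} \<times> {v \<in> V. t v = n - i})"
  by auto

lemma finite_fibers_Times:
  assumes "finite_fibers W s" "finite_fibers V t"
  shows "finite_fibers (W \<times> V) (\<lambda>(w, v). s w + t v)"
  unfolding finite_fibers_def fiber_Times using assms by (simp add: finite_fibers_def)

lemma gen_fps_Times:
  fixes f :: "'i \<Rightarrow> 'c::comm_ring_1"
  assumes "finite_fibers W s" "finite_fibers V t"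
  shows "gen_fps (W \<times> V) (\<lambda>(w, v). f w * g v) (\<lambda>(w, v). s w + t v) = gen_fps W f s * gen_fps V g t"
proof (rule fps_ext)
  fix n
  have "fps_nth (gen_fps (W \<times> V) (\<lambda>(w, v). f w * g v) (\<lambda>(w, v). s w + t v)) n =
      (\<Sum>i\<in>{0..n}. \<Sum>(w, v)\<in>{w \<in> W. s w = i} \<times> {v \<in> V. t v = n - i}. f w * g v)"
    unfolding gen_fps_nth fiber_Times
    by (rule sum.UNION_disjoint) (use assms in \<open>auto simp: finite_fibers_def\<close>)
  also have "\<dots> = fps_nth (gen_fps W f s * gen_fps V g t) n"
    unfolding fps_mult_nth gen_fps_nth by (simp add: sum_product sum.cartesian_product)
  finally show "fps_nth (gen_fps (W \<times> V) (\<lambda>(w, v). f w * g v) (\<lambda>(w, v). s w + t v)) n =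
    fps_nth (gen_fps W f s * gen_fps V g t) n" .
qed

lemma finite_fibers_reindex:
  assumes "finite_fibers V (\<lambda>v. s (h v))" shows "finite_fibers (h ` V) s"
proof -
  have "{w \<in> h ` V. s w = n} = h ` {v \<in> V. s (h v) = n}" for n by auto
  then show ?thesis using assms unfolding finite_fibers_def by simp
qed

lemma finite_fibers_multiples:
  assumes "0 < (m :: nat)" shows "finite_fibers {0<..} (\<lambda>k. k * m)"
  unfolding finite_fibers_def
proof
  fix n
  have "k \<le> n" if "k * m = n" for k using that assms by (cases m) auto
  then have "{k \<in> {0<..}. k * m = n} \<subseteq> {..n}" by auto
  then show "finite {k \<in> {0<..}. k * m = n}" using finite_subset by blast
qed

text \<open>Splitting off k = 1 gives the equation G = x + x * G, which is solved by cancelling 1 -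
  x. Since m is positive, fibres are finite and 1 - x has constant term 1.\<close>

lemma gen_fps_geometric:
  fixes a :: "'c::field"
  assumes m: "0 < m"
  defines "x \<equiv> fps_const a * fps_X ^ m"
  shows "gen_fps {0<..} (\<lambda>k. a ^ k) (\<lambda>k. k * m) = x / (1 - x)"
proof -
  define G where "G = gen_fps {0<..} (\<lambda>k. a ^ k) (\<lambda>k. k * m)"
  have "G = x + x * G"
  proof (rule fps_ext)
    fix n
    have xn: "fps_nth (x + x * G) n = (if n = m then a else 0) + (if n < m then 0 else a * fps_nth G (n - m))"
      unfolding x_def by (simp add: mult.assoc fps_X_power_mult_nth fps_X_power_nth)
    show "fps_nth G n = fps_nth (x + x * G) n"
    proof (cases "n < m")
      case True
      then have none: "{k \<in> {0<..}. k * m = n} = {}" by auto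
      have "fps_nth G n = 0" unfolding G_def gen_fps_nth none by simp
      then show ?thesis unfolding xn using True by simp
    next
      case False
      then obtain d where d: "n = m + d" using le_Suc_ex not_less by blast
      have S: "{k \<in> {0<..}. k * m = n} = Suc ` {k. k * m = d}"
        unfolding d by (auto simp: image_iff gr0_conv_Suc)
      have Gn: "fps_nth G n = (\<Sum>k\<in>{k. k * m = d}. a * a ^ k)"
        unfolding G_def gen_fps_nth S by (simp add: sum.reindex)
      show ?thesis
      proof (cases "d = 0")
        case True
        \<comment> \<open>At n = m the only index is k = 1, which comes from the summand x. The
          product x * G contributes nothing there, as k = 0 is excluded and G has constant term
          0.\<close>
        have zero: "{k. k * m = d} = {0}" and none: "{k \<in> {0<..}. k * m = 0} = {}" using True m by auto
        have "fps_nth G 0 = 0" unfolding G_def gen_fps_nth none by simp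
        moreover have "fps_nth G n = a" unfolding Gn zero by simp
        ultimately show ?thesis unfolding xn using True d by simp
      next
        case False
        then have "{k \<in> {0<..}. k * m = d} = {k. k * m = d}" by (auto intro: ccontr)
        then show ?thesis unfolding xn Gn using False d by (simp add: G_def gen_fps_nth sum_distrib_left)
      qed
    qed
  qed
  then have "G * (1 - x) = x" by (simp add: algebra_simps)
  moreover have "fps_nth (1 - x) 0 \<noteq> 0" unfolding x_def using m by (simp add: fps_X_power_nth)
  then have "1 - x \<noteq> 0" by (metis fps_zero_nth)
  ultimately show ?thesis unfolding G_def[symmetric] by (metis nonzero_mult_div_cancel_right)
qed

text \<open>Coordinates vary independently and both the size and the coefficient split over them, so
  the generating function is a product of geometric series. Finiteness is proved in the same
  induction because the product rule asks for it.\<close>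

lemma gen_fps_PiE:
  fixes a :: "'i \<Rightarrow> 'c::field" and m :: "'i \<Rightarrow> nat"
  assumes "finite S" "\<And>F. F \<in> S \<Longrightarrow> 0 < m F"
  shows "finite_fibers (S \<rightarrow>\<^sub>E {0<..}) (\<lambda>c. \<Sum>F\<in>S. c F * m F) \<and>
    gen_fps (S \<rightarrow>\<^sub>E {0<..}) (\<lambda>c. \<Prod>F\<in>S. a F ^ c F) (\<lambda>c. \<Sum>F\<in>S. c F * m F) =
    (\<Prod>F\<in>S. fps_const (a F) * fps_X ^ m F / (1 - fps_const (a F) * fps_X ^ m F))"
  using assms
proof (induction S rule: finite_induct)
  case empty
  have "gen_fps {\<lambda>x. undefined} (\<lambda>c. 1 :: 'c) (\<lambda>c. 0) = 1"
    by (rule fps_ext) (simp add: gen_fps_nth)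
  then show ?case by (simp add: finite_fibers_def)
next
  case (insert F S)
  let ?h = "\<lambda>(y :: nat, g). g(F := y)"
  let ?V = "{0<..} \<times> (S \<rightarrow>\<^sub>E {0<..})"
  have W: "(insert F S \<rightarrow>\<^sub>E {0<..}) = ?h ` ?V" by (rule PiE_insert_eq)
  have inj: "inj_on ?h ?V"
  proof (rule inj_onI, clarify)
    fix y g y' g'
    assume g: "g \<in> S \<rightarrow>\<^sub>E {0<..}" "g' \<in> S \<rightarrow>\<^sub>E {0<..}" and eq: "g(F := y) = g'(F := y')"
    \<comment> \<open>Both functions are extensional on S and F lies outside S, so both are
      undefined at F and the update can be undone.\<close>
    have "g F = g' F" using g insert.hyps by (simp add: PiE_arb[where S = S])
    then show "y = y' \<and> g = g'" using eq by (metis fun_upd_eqD fun_upd_triv fun_upd_upd)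
  qed
  have sumF: "(\<Sum>G\<in>insert F S. ?h v G * m G) = (case v of (k, c) \<Rightarrow> k * m F + (\<Sum>G\<in>S. c G * m G))" for v
    using insert.hyps by (auto split: prod.split intro!: sum.cong)
  have prodF: "(\<Prod>G\<in>insert F S. a G ^ ?h v G) = (case v of (k, c) \<Rightarrow> a F ^ k * (\<Prod>G\<in>S. a G ^ c G))" for v
  proof (cases v)
    case (Pair k c)
    have "(\<Prod>G\<in>S. a G ^ (c(F := k)) G) = (\<Prod>G\<in>S. a G ^ c G)"
      using insert.hyps by (intro prod.cong) auto
    then show ?thesis using insert.hyps Pair by simp
  qed
  have IH: "finite_fibers (S \<rightarrow>\<^sub>E {0<..}) (\<lambda>c. \<Sum>F\<in>S. c F * m F)"
    "gen_fps (S \<rightarrow>\<^sub>E {0<..}) (\<lambda>c. \<Prod>F\<in>S. a F ^ c F) (\<lambda>c. \<Sum>F\<in>S. c F * m F) =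
    (\<Prod>F\<in>S. fps_const (a F) * fps_X ^ m F / (1 - fps_const (a F) * fps_X ^ m F))"
    using insert.IH insert.prems by simp_all
  have F: "finite_fibers {0<..} (\<lambda>k. k * m F)" using insert.prems by (simp add: finite_fibers_multiples)
  show ?case
  proof
    show "finite_fibers (insert F S \<rightarrow>\<^sub>E {0<..}) (\<lambda>c. \<Sum>F\<in>insert F S. c F * m F)"
      unfolding W using finite_fibers_Times[OF F IH(1)] by (intro finite_fibers_reindex) (simp only: sumF)
    show "gen_fps (insert F S \<rightarrow>\<^sub>E {0<..}) (\<lambda>c. \<Prod>F\<in>insert F S. a F ^ c F) (\<lambda>c. \<Sum>F\<in>insert F S. c F * m F) =
      (\<Prod>F\<in>insert F S. fps_const (a F) * fps_X ^ m F / (1 - fps_const (a F) * fps_X ^ m F))"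
      unfolding W gen_fps_reindex[OF inj] sumF prodF gen_fps_Times[OF F IH(1)] IH(2)
      using insert by (simp add: gen_fps_geometric)
  qed
qed

section \<open>Decomposition of weights along nested sets\<close>

context loopless_building
begin

text \<open>Coefficients live on the whole building set, with 0 allowed, and the nested set is
  recovered as the support \<open>supp\<close>. Adding or removing a superlevel set then changes the
  function only, even when the support changes.\<close>

definition val :: "('a set \<Rightarrow> nat) \<Rightarrow> 'a \<Rightarrow> nat" where
  "val c e = (\<Sum>F\<in>{F \<in> \<G>. e \<in> F}. c F)"

definition supp :: "('a set \<Rightarrow> nat) \<Rightarrow> 'a set set" where
  "supp c = {F \<in> \<G>. 0 < c F}"

lemma val_pos: "0 < val c e \<longleftrightarrow> e \<in> \<Union> (supp c)"
proof -
  have "finite {F \<in> \<G>. e \<in> F}" using finite_building by simp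
  then have "val c e = 0 \<longleftrightarrow> (\<forall>F\<in>{F \<in> \<G>. e \<in> F}. c F = 0)" unfolding val_def by (rule sum_eq_0_iff)
  then show ?thesis unfolding supp_def by auto
qed

text \<open>The factors of X partition X, so their indicator vectors sum to that of X.\<close>

lemma val_add_fact:
  assumes X: "X \<in> flats M"
  shows "val (\<lambda>F. c F + (if F \<in> fact_set \<G> X then 1 else 0)) e = val c e + (if e \<in> X then 1 else 0)"
proof -
  have fin: "finite {F \<in> \<G>. e \<in> F}" using finite_building by simp
  have "(\<Sum>F\<in>{F \<in> \<G>. e \<in> F}. if F \<in> fact_set \<G> X then 1 else 0) = (if e \<in> X then 1 else (0::nat))"
  proof (cases "e \<in> X")
    case True
    then obtain G where G: "G \<in> fact_set \<G> X" "e \<in> G" using Union_fact[OF X] by auto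
    then have "{F \<in> \<G>. e \<in> F} \<inter> fact_set \<G> X = {G}"
      using fact_unique[OF X] subsetD[OF fact_subset G(1)] by auto
    then show ?thesis using True fin by (simp add: sum.If_cases Int_def)
  next
    case False
    then have "F \<notin> fact_set \<G> X" if "e \<in> F" for F using Union_fact[OF X] that by auto
    then show ?thesis using False by auto
  qed
  then show ?thesis unfolding val_def by (simp add: sum.distrib)
qed

text \<open>Both supports have the same union X, the set where the common value is positive, and
  hence the same maximal members, namely the factors of X. Lowering each of these by one in both
  functions keeps the hypotheses and decreases the total of the coefficients.\<close>

lemma decomposition_unique:
  "\<lbrakk>nested M \<G> (supp c); nested M \<G> (supp c'); \<And>e. e \<in> ground M \<Longrightarrow> val c e = val c' e; F \<in> \<G>\<rbrakk>
    \<Longrightarrow> c F = c' F"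
proof (induction "\<Sum>F\<in>\<G>. c F" arbitrary: c c' rule: less_induct)
  case less
  define X where "X = \<Union> (supp c)"
  have sub: "\<Union> (supp b) \<subseteq> ground M" for b using building_ground unfolding supp_def by auto
  have X': "\<Union> (supp c') = X"
  proof -
    have "e \<in> \<Union> (supp c') \<longleftrightarrow> e \<in> \<Union> (supp c)" if "e \<in> ground M" for e
      using less.prems(3)[OF that] val_pos[of c e] val_pos[of c' e] by simp
    then show ?thesis using sub[of c] sub[of c'] unfolding X_def by blast
  qed
  have Xf: "X \<in> flats M" and fact: "fact_set \<G> X = maximal_sets (supp c)"
    and fact': "fact_set \<G> X = maximal_sets (supp c')"
    using nested_maximal[OF less.prems(1)] nested_maximal[OF less.prems(2)] X' unfolding X_def by auto
  show ?case
  proof (cases "X = {}")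
    case True
    have "supp b = {}" if "\<Union> (supp b) = {}" for b
      using that building_nonempty unfolding supp_def by fastforce
    then have "supp c = {}" "supp c' = {}" using X' True unfolding X_def by simp_all
    then show ?thesis using less.prems(4) unfolding supp_def by auto
  next
    case False
    \<comment> \<open>The truncated subtraction is exact: factors of X are maximal members of the
      support, so their coefficients are positive, as \<open>add\<close> records.\<close>
    define peel where "peel b = (\<lambda>F. b F - (if F \<in> fact_set \<G> X then 1 else 0))" for b :: "'a set \<Rightarrow> nat"
    have add: "b = (\<lambda>F. peel b F + (if F \<in> fact_set \<G> X then 1 else 0))"
      if "fact_set \<G> X = maximal_sets (supp b)" for b
    proof
      fix F
      have "0 < b F" if "F \<in> fact_set \<G> X"
        using that \<open>fact_set \<G> X = maximal_sets (supp b)\<close> unfolding maximal_sets_def supp_def by auto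
      then show "b F = peel b F + (if F \<in> fact_set \<G> X then 1 else 0)" unfolding peel_def by auto
    qed
    \<comment> \<open>Peeling may remove members from the support but never adds any, and nestedness
      passes to subsets.\<close>
    have nest: "nested M \<G> (supp (peel b))" if "nested M \<G> (supp b)" for b
      by (rule nested_subset[OF that]) (auto simp: supp_def peel_def)
    obtain e where "e \<in> X" using False by auto
    then obtain G where G: "G \<in> fact_set \<G> X" using Union_fact[OF Xf] by auto
    have "(\<Sum>F\<in>\<G>. peel c F) < (\<Sum>F\<in>\<G>. c F)"
    proof (rule sum_strict_mono_ex1[OF finite_building])
      show "\<forall>F\<in>\<G>. peel c F \<le> c F" unfolding peel_def by simp
      have "peel c G < c G" using fun_cong[OF add[OF fact], of G] G by simp
      then show "\<exists>F\<in>\<G>. peel c F < c F" using G fact_subset by auto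
    qed
    moreover have "val (peel c) e = val (peel c') e" if "e \<in> ground M" for e
    proof -
      have "val c e = val (peel c) e + (if e \<in> X then 1 else 0)"
        by (subst add[OF fact]) (rule val_add_fact[OF Xf])
      moreover have "val c' e = val (peel c') e + (if e \<in> X then 1 else 0)"
        by (subst add[OF fact']) (rule val_add_fact[OF Xf])
      ultimately show ?thesis using less.prems(3)[OF that] by simp
    qed
    ultimately have "peel c F = peel c' F"
      using less.hyps[of "peel c" "peel c'"] nest less.prems by simp
    then show ?thesis using fun_cong[OF add[OF fact], of F] fun_cong[OF add[OF fact'], of F] by simp
  qed
qed

text \<open>Factors of X are maximal in the building set below X. An antichain that uses one of them
  and has its join in the building set would therefore have that factor as its join, and the factor
  would contain all the other members.\<close>

lemma nested_Un_fact:
  assumes S: "nested M \<G> \<S>" and X: "\<Union>\<S> \<subseteq> X" "X \<in> flats M"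
  shows "nested M \<G> (\<S> \<union> fact_set \<G> X)"
  unfolding nested_def
proof (intro conjI allI impI)
  show "\<S> \<union> fact_set \<G> X \<subseteq> \<G>" using nested_building[OF S] fact_subset by simp
  fix \<A>
  assume sub: "\<A> \<subseteq> \<S> \<union> fact_set \<G> X"
    and A: "2 \<le> card \<A> \<and> (\<forall>F\<in>\<A>. \<forall>G\<in>\<A>. F \<noteq> G \<longrightarrow> \<not> F \<subseteq> G \<and> \<not> G \<subseteq> F)"
  have inX: "\<Union>\<A> \<subseteq> X" 
  proof (rule Union_least)
    fix F assume "F \<in> \<A>"
    then have "F \<in> \<S> \<or> F \<in> fact_set \<G> X" using sub by auto
    then show "F \<subseteq> X" using X(1) unfolding fact_set_def by auto
  qed
  then have Ag: "\<Union>\<A> \<subseteq> ground M" using flats_ground[OF X(2)] by auto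
  show "mcl M (\<Union>\<A>) \<notin> \<G>"
  proof
    assume J: "mcl M (\<Union>\<A>) \<in> \<G>"
    have "\<A> \<inter> fact_set \<G> X = {}"
    proof (rule equals0I)
      fix G assume G: "G \<in> \<A> \<inter> fact_set \<G> X"
      then have "mcl M (\<Union>\<A>) = G"
        using fact_maximal[OF _ J] subset_mcl[OF Ag] mcl_subset_flat[OF inX X(2)] by auto
      then have "F \<subseteq> G" if "F \<in> \<A>" for F
        using Union_upper[OF that] subset_mcl[OF Ag] by simp
      then have "F = G" if "F \<in> \<A>" for F
        using A G that by (metis IntD1)
      then have "\<A> \<subseteq> {G}" by auto
      then have "card \<A> \<le> card {G}" by (intro card_mono) auto
      then show False using A by simp
    qed
    then have "\<A> \<subseteq> \<S>" using sub by auto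
    then show False using nested_join[OF S, of \<A>] A J by metis
  qed
qed

text \<open>Lowering w by one on X = {w \<ge> 1} shifts the superlevel sets by one level. The
  decomposition of the lowered weight is supported inside X, and that is the condition under which
  the factors of X may be added to a nested set.\<close>

lemma decomposition_exists:
  fixes w :: "'a \<Rightarrow> nat"
  shows "(\<And>k. {e \<in> ground M. k \<le> w e} \<in> flats M) \<Longrightarrow>
    \<exists>c. nested M \<G> (supp c) \<and> (\<forall>e\<in>ground M. val c e = w e)"
proof (induction "\<Sum>e\<in>ground M. w e" arbitrary: w rule: less_induct)
  case less
  define X where "X = {e \<in> ground M. 1 \<le> w e}"
  have X: "X \<in> flats M" unfolding X_def by (rule less.prems)
  show ?case
  proof (cases "X = {}")
    case True
    have "supp (\<lambda>_. 0) = {}" unfolding supp_def by simp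
    moreover have "\<forall>e\<in>ground M. val (\<lambda>_. 0) e = w e" using True unfolding X_def val_def by auto
    ultimately show ?thesis using nested_empty by (intro exI[of _ "\<lambda>_. 0"]) simp
  next
    case False
    define u where "u e = w e - 1" for e
    obtain e where e: "e \<in> ground M" "1 \<le> w e" using False unfolding X_def by auto
    have "(\<Sum>e\<in>ground M. u e) < (\<Sum>e\<in>ground M. w e)"
    proof (rule sum_strict_mono_ex1[OF finite_ground])
      show "\<forall>e\<in>ground M. u e \<le> w e" "\<exists>e\<in>ground M. u e < w e"
        using e unfolding u_def by (auto intro!: bexI[of _ e])
    qed
    moreover have "{e \<in> ground M. k \<le> u e} \<in> flats M" for k
    proof (cases k)
      case 0
      \<comment> \<open>Level 0 is separate: its superlevel set is the whole ground set and does not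
        arise by shifting.\<close>
      then show ?thesis using ground_in_flats by simp
    next
      case (Suc j)
      then have "{e \<in> ground M. k \<le> u e} = {e \<in> ground M. Suc k \<le> w e}" unfolding u_def by auto
      then show ?thesis using less.prems by simp
    qed
    ultimately obtain c where c: "nested M \<G> (supp c)" "\<And>e. e \<in> ground M \<Longrightarrow> val c e = u e"
      using less.hyps[of u] by auto
    define b where "b = (\<lambda>F. c F + (if F \<in> fact_set \<G> X then 1 else 0))"
    have "\<Union> (supp c) \<subseteq> X"
    proof
      fix e assume e: "e \<in> \<Union> (supp c)"
      then have eg: "e \<in> ground M" using building_ground unfolding supp_def by auto
      have "0 < val c e" using e val_pos by simp
      then show "e \<in> X" using c(2)[OF eg] eg unfolding X_def u_def by simp
    qed
    then have "nested M \<G> (supp c \<union> fact_set \<G> X)" by (rule nested_Un_fact[OF c(1) _ X])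
    moreover have "supp b = supp c \<union> fact_set \<G> X"
      using fact_subset[of X] unfolding supp_def b_def by auto
    moreover have "val b e = w e" if "e \<in> ground M" for e
    proof -
      have "val b e = u e + (if e \<in> X then 1 else 0)"
        unfolding b_def val_add_fact[OF X] c(2)[OF that] by simp
      then show ?thesis using that unfolding u_def X_def by auto
    qed
    ultimately show ?thesis by (intro exI[of _ b] conjI ballI) simp_all
  qed
qed

end

text \<open>This is the point \<Sum> c F \<cdot> \<one>_F. The coefficient type is left open because
  it serves both for natural weights and for real points of the cone.\<close>

definition cone_vector :: "'a set set \<Rightarrow> ('a set \<Rightarrow> 'b::comm_monoid_add) \<Rightarrow> 'a \<Rightarrow> 'b" where
  "cone_vector \<S> c e = (\<Sum>F\<in>{F \<in> \<S>. e \<in> F}. c F)"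

lemma sum_cone_vector:
  fixes c :: "'a set \<Rightarrow> 'b::semiring_1"
  assumes "finite \<S>" "finite B"
  shows "(\<Sum>e\<in>B. cone_vector \<S> c e) = (\<Sum>F\<in>\<S>. of_nat (card (F \<inter> B)) * c F)"
proof -
  have "(\<Sum>e\<in>B. cone_vector \<S> c e) = (\<Sum>e\<in>B. \<Sum>F\<in>\<S>. if e \<in> F then c F else 0)"
    unfolding cone_vector_def using assms by (simp add: sum.inter_filter)
  also have "\<dots> = (\<Sum>F\<in>\<S>. \<Sum>e\<in>B. if e \<in> F then c F else 0)" by (rule sum.swap)
  also have "\<dots> = (\<Sum>F\<in>\<S>. of_nat (card (F \<inter> B)) * c F)"
  proof (rule sum.cong[OF refl])
    fix F
    show "(\<Sum>e\<in>B. if e \<in> F then c F else 0) = of_nat (card (F \<inter> B)) * c F"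
      using assms sum.inter_filter[of B "\<lambda>_. c F" "\<lambda>e. e \<in> F"]
      by (simp add: Int_def conj_commute)
  qed
  finally show ?thesis .
qed

text \<open>By double counting a basis B has weight \<Sum> c F * |F \<inter> B|, which is at most
  \<Sum> c F * rk F; as all c F are positive, equality holds exactly when B spans every F. The
  resulting description contains neither c nor its type, so it links initial matroids of natural
  weights with the one defined by a real point of the cone.\<close>

lemma (in loopless_building) init_matroid_nested:
  fixes w :: "'a \<Rightarrow> 'b::linordered_semidom"
  assumes S: "nested M \<G> \<S>" and pos: "\<And>F. F \<in> \<S> \<Longrightarrow> 0 < c F"
    and w: "\<And>e. e \<in> ground M \<Longrightarrow> w e = cone_vector \<S> c e"
  shows wt_nested: "wt M w = (\<Sum>F\<in>\<S>. of_nat (mrank M F) * c F)"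
    and "init_matroid M w = M\<lparr>bases := {B \<in> bases M. \<forall>F\<in>\<S>. card (F \<inter> B) = mrank M F}\<rparr>"
proof -
  have fin: "finite \<S>" by (rule nested_finite[OF S])
  have sum: "(\<Sum>e\<in>B. w e) = (\<Sum>F\<in>\<S>. of_nat (card (F \<inter> B)) * c F)" if "B \<in> bases M" for B
  proof -
    have "(\<Sum>e\<in>B. w e) = (\<Sum>e\<in>B. cone_vector \<S> c e)"
      using w bases_ground[OF that] by (intro sum.cong) auto
    then show ?thesis using sum_cone_vector[OF fin finite_basis[OF that]] by simp
  qed
  have le: "of_nat (card (F \<inter> B)) * c F \<le> of_nat (mrank M F) * c F" if "B \<in> bases M" "F \<in> \<S>" for B F
    using card_Int_basis_le[OF that(1)] pos[OF that(2)] by (intro mult_right_mono) auto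
  obtain B0 where B0: "B0 \<in> bases M" "\<forall>F\<in>\<S>. card (F \<inter> B0) = mrank M F"
    using nested_basis[OF S] by auto
  show wt: "wt M w = (\<Sum>F\<in>\<S>. of_nat (mrank M F) * c F)"
  proof (rule wt_eqI[OF B0(1)])
    show "(\<Sum>e\<in>B0. w e) = (\<Sum>F\<in>\<S>. of_nat (mrank M F) * c F)" using sum[OF B0(1)] B0(2) by simp
    fix B assume B: "B \<in> bases M"
    show "(\<Sum>e\<in>B. w e) \<le> (\<Sum>F\<in>\<S>. of_nat (mrank M F) * c F)"
      unfolding sum[OF B] by (intro sum_mono le B)
  qed
  have "(\<Sum>e\<in>B. w e) = wt M w \<longleftrightarrow> (\<forall>F\<in>\<S>. card (F \<inter> B) = mrank M F)" if B: "B \<in> bases M" for B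
  proof
    assume eq: "(\<Sum>e\<in>B. w e) = wt M w"
    show "\<forall>F\<in>\<S>. card (F \<inter> B) = mrank M F"
    proof (rule ballI, rule ccontr)
      fix F assume F: "F \<in> \<S>" and "card (F \<inter> B) \<noteq> mrank M F"
      then have "card (F \<inter> B) < mrank M F" using card_Int_basis_le[OF B, of F] by simp
      then have "of_nat (card (F \<inter> B)) * c F < of_nat (mrank M F) * c F"
        using pos[OF F] by (intro mult_strict_right_mono) auto
      then have "(\<Sum>F\<in>\<S>. of_nat (card (F \<inter> B)) * c F) < (\<Sum>F\<in>\<S>. of_nat (mrank M F) * c F)"
        using le[OF B] F by (intro sum_strict_mono_ex1[OF fin]) auto
      then show False using eq sum[OF B] wt by simp
    qed
  next
    assume "\<forall>F\<in>\<S>. card (F \<inter> B) = mrank M F"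
    then show "(\<Sum>e\<in>B. w e) = wt M w" using sum[OF B] wt by simp
  qed
  then have "{B \<in> bases M. (\<Sum>e\<in>B. w e) = wt M w} = {B \<in> bases M. \<forall>F\<in>\<S>. card (F \<inter> B) = mrank M F}"
    by (intro Collect_cong) auto
  then show "init_matroid M w = M\<lparr>bases := {B \<in> bases M. \<forall>F\<in>\<S>. card (F \<inter> B) = mrank M F}\<rparr>"
    unfolding init_matroid_def by simp
qed

section \<open>The relative interior of the cone of a nested set\<close>

lemma nested_cone_subset:
  "nested_cone \<S> \<subseteq> {w. \<exists>c. (\<forall>F\<in>\<S>. 0 \<le> c F) \<and> (\<forall>e. w $ e = cone_vector \<S> c e)}"
  unfolding nested_cone_def
proof (rule hull_minimal)
  let ?C = "{w :: real ^ 'a. \<exists>c. (\<forall>F\<in>\<S>. 0 \<le> c F) \<and> (\<forall>e. w $ e = cone_vector \<S> c e)}"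
  show "indicator_vec ` \<S> \<subseteq> ?C"
  proof clarify
    fix F assume F: "F \<in> \<S>"
    have "indicator_vec F $ e = cone_vector \<S> (\<lambda>G. if G = F then 1 else 0) e" for e
      using F by (simp add: indicator_vec_def cone_vector_def indicator_def)
    then show "\<exists>c. (\<forall>F\<in>\<S>. 0 \<le> c F) \<and> (\<forall>e. indicator_vec F $ e = cone_vector \<S> c e)"
      by (intro exI[of _ "\<lambda>G. if G = F then 1 else 0"]) auto
  qed
  have "0 \<in> ?C" by (auto simp: cone_vector_def intro!: exI[of _ "\<lambda>_. 0"])
  moreover have "x + y \<in> ?C" if xC: "x \<in> ?C" and yC: "y \<in> ?C" for x y
  proof -
    obtain c where "\<forall>F\<in>\<S>. 0 \<le> c F" "\<forall>e. x $ e = cone_vector \<S> c e"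
      using xC unfolding mem_Collect_eq by (elim exE conjE)
    moreover obtain d where "\<forall>F\<in>\<S>. 0 \<le> d F" "\<forall>e. y $ e = cone_vector \<S> d e"
      using yC unfolding mem_Collect_eq by (elim exE conjE)
    ultimately show ?thesis
      by (auto simp: cone_vector_def sum.distrib intro!: exI[of _ "\<lambda>F. c F + d F"])
  qed
  moreover have "t *\<^sub>R x \<in> ?C" if xC: "x \<in> ?C" and t: "0 \<le> t" for x t
  proof -
    obtain c where "\<forall>F\<in>\<S>. 0 \<le> c F" "\<forall>e. x $ e = cone_vector \<S> c e"
      using xC unfolding mem_Collect_eq by (elim exE conjE)
    then show ?thesis using t
      by (auto simp: cone_vector_def sum_distrib_left intro!: exI[of _ "\<lambda>F. t * c F"])
  qed
  ultimately show "convex_cone ?C" unfolding convex_cone_iff by blast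
qed

text \<open>A point w of the relative interior can be overshot: going from the sum p of all
  generators through w and slightly beyond stays in the cone. Solving (1 - t) p + t w = \<Sum> c F
  \<cdot> \<one>_F for w gives the coefficients (c F + (t - 1)) / t, which are positive since t >
  1.\<close>

lemma rel_interior_nested_cone:
  fixes \<S> :: "'a::finite set set"
  assumes w: "w \<in> rel_interior (nested_cone \<S>)"
  shows "\<exists>c. (\<forall>F\<in>\<S>. 0 < c F) \<and> (\<forall>e. w $ e = cone_vector \<S> c e)"
proof -
  define p where "p = (\<Sum>F\<in>\<S>. indicator_vec F)"
  have C: "convex_cone (nested_cone \<S>)" unfolding nested_cone_def by (rule convex_cone_convex_cone_hull)
  have ind: "indicator_vec F \<in> nested_cone \<S>" if "F \<in> \<S>" for F
    unfolding nested_cone_def using that by (intro hull_inc) simp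
  have "T \<subseteq> \<S> \<longrightarrow> (\<Sum>F\<in>T. indicator_vec F) \<in> nested_cone \<S>" for T
    by (rule finite_induct[OF finite[of T]])
      (auto intro!: convex_cone_add[OF C] ind simp: convex_cone_contains_0[OF C])
  then have p: "p \<in> nested_cone \<S>" unfolding p_def by simp
  have "convex (nested_cone \<S>)" "nested_cone \<S> \<noteq> {}" using C unfolding convex_cone_def by auto
  from convex_rel_interior_iff[OF this, of w] obtain t where t: "1 < t"
    and "(1 - t) *\<^sub>R p + t *\<^sub>R w \<in> nested_cone \<S>" using w p by auto
  then obtain c where c: "\<forall>F\<in>\<S>. 0 \<le> c F"
    "\<forall>e. ((1 - t) *\<^sub>R p + t *\<^sub>R w) $ e = cone_vector \<S> c e"
    using nested_cone_subset[of \<S>] by auto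
  have pe: "p $ e = (\<Sum>F\<in>{F \<in> \<S>. e \<in> F}. 1)" for e
    unfolding p_def by (simp add: indicator_vec_def indicator_def sum.If_cases Int_def)
  have "w $ e = cone_vector \<S> (\<lambda>F. (c F + (t - 1)) / t) e" for e
  proof -
    have "(1 - t) * p $ e + t * w $ e = cone_vector \<S> c e" using c(2) by simp
    then have "t * w $ e = (\<Sum>F\<in>{F \<in> \<S>. e \<in> F}. c F + (t - 1))"
      unfolding pe cone_vector_def sum.distrib by (simp add: algebra_simps)
    then show ?thesis using t unfolding cone_vector_def sum_divide_distrib[symmetric]
      by (simp add: field_simps)
  qed
  moreover have "0 < (c F + (t - 1)) / t" if "F \<in> \<S>" for F using bspec[OF c(1) that] t by simp
  ultimately show ?thesis by (intro exI[of _ "\<lambda>F. (c F + (t - 1)) / t"]) simp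
qed

text \<open>Whichever point the choice operator picks, it has positive coefficients, and the initial
  matroid depends on nothing else.\<close>

lemma nested_matroid_eq:
  fixes M :: "'a::finite matroid"
  assumes "loopless_building M \<G>" and S: "nested M \<G> \<S>"
  shows "nested_matroid M \<S> = M\<lparr>bases := {B \<in> bases M. \<forall>F\<in>\<S>. card (F \<inter> B) = mrank M F}\<rparr>"
proof -
  interpret loopless_building M \<G> by fact
  have "(SOME w. w \<in> rel_interior (nested_cone \<S>)) \<in> rel_interior (nested_cone \<S>)"
    by (rule someI_ex) (simp add: ex_in_conv rel_interior_nested_cone_nonempty)
  from rel_interior_nested_cone[OF this] obtain c where "\<forall>F\<in>\<S>. 0 < c F"
    "\<forall>e. (SOME w. w \<in> rel_interior (nested_cone \<S>)) $ e = cone_vector \<S> c e"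
    by (elim exE conjE)
  then show ?thesis unfolding nested_matroid_def
    by (intro init_matroid_nested(2)[OF S, of c]) auto
qed

section \<open>Summation over nested cones\<close>

text \<open>The restriction to E makes the weight an extensional function, as are the weights over
  which the zeta functions sum.\<close>

definition cone_weight :: "'a set \<Rightarrow> 'a set set \<Rightarrow> ('a set \<Rightarrow> nat) \<Rightarrow> 'a \<Rightarrow> nat" where
  "cone_weight E \<S> c = (\<lambda>e\<in>E. cone_vector \<S> c e)"

lemma cone_vector_pos:
  fixes c :: "'a set \<Rightarrow> nat"
  assumes "finite \<S>" "\<And>F. F \<in> \<S> \<Longrightarrow> 0 < c F"
  shows "0 < cone_vector \<S> c e \<longleftrightarrow> e \<in> \<Union>\<S>"
proof -
  have "cone_vector \<S> c e = 0 \<longleftrightarrow> (\<forall>F\<in>{F \<in> \<S>. e \<in> F}. c F = 0)"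
    unfolding cone_vector_def using assms(1) by (intro sum_eq_0_iff) simp
  then show ?thesis using assms(2) by fastforce
qed

context loopless_building
begin

lemma finite_nested_sets: "finite (nested_sets M \<G>)"
  using finite_subset[of "nested_sets M \<G>" "Pow \<G>"] finite_building nested_building
  unfolding nested_sets_def by auto

lemma val_restrict:
  assumes "\<S> \<subseteq> \<G>" shows "val (\<lambda>F. if F \<in> \<S> then c F else 0) e = cone_vector \<S> c e"
  unfolding val_def cone_vector_def
  by (rule sum.mono_neutral_cong_right) (use assms finite_building in auto)

lemma supp_restrict:
  assumes "\<S> \<subseteq> \<G>" "\<And>F. F \<in> \<S> \<Longrightarrow> 0 < c F"
  shows "supp (\<lambda>F. if F \<in> \<S> then c F else 0) = \<S>"
  using assms unfolding supp_def by auto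

text \<open>Extending c by 0 outside \<open>\<S>\<close> gives a coefficient function with support
  \<open>\<S>\<close>, so uniqueness of the decomposition recovers both components of the
  pair.\<close>

lemma inj_cone_weight:
  "inj_on (\<lambda>(\<S>, c). cone_weight (ground M) \<S> c) (SIGMA \<S>:nested_sets M \<G>. \<S> \<rightarrow>\<^sub>E {0<..})"
proof (rule inj_onI, clarify)
  fix \<S> c \<S>' c'
  assume "\<S> \<in> nested_sets M \<G>" "\<S>' \<in> nested_sets M \<G>"
    and c: "c \<in> \<S> \<rightarrow>\<^sub>E {0<..}" "c' \<in> \<S>' \<rightarrow>\<^sub>E {0<..}"
    and eq: "cone_weight (ground M) \<S> c = cone_weight (ground M) \<S>' c'"
  then have S: "nested M \<G> \<S>" "nested M \<G> \<S>'" unfolding nested_sets_def by auto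
  note G = nested_building[OF S(1)] nested_building[OF S(2)]
  define b where "b = (\<lambda>F. if F \<in> \<S> then c F else 0)"
  define b' where "b' = (\<lambda>F. if F \<in> \<S>' then c' F else 0)"
  have pos: "F \<in> \<S> \<Longrightarrow> 0 < c F" "F \<in> \<S>' \<Longrightarrow> 0 < c' F" for F using c by (auto simp: PiE_iff)
  have sb: "supp b = \<S>" "supp b' = \<S>'"
    unfolding b_def b'_def using supp_restrict[OF G(1) pos(1)] supp_restrict[OF G(2) pos(2)] by simp_all
  have "val b e = val b' e" if "e \<in> ground M" for e
    using fun_cong[OF eq, of e] that val_restrict[OF G(1)] val_restrict[OF G(2)]
    unfolding b_def b'_def cone_weight_def by simp
  then have bb: "b F = b' F" if "F \<in> \<G>" for F
    using decomposition_unique[of b b'] S sb that by simp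
  then have SS: "\<S> = \<S>'" using sb unfolding supp_def by auto
  have "c F = c' F" if "F \<in> \<S>" for F using bb[of F] G that SS unfolding b_def b'_def by auto
  then have "c = c'" using c SS by (auto intro: PiE_ext)
  then show "\<S> = \<S>' \<and> c = c'" using SS by simp
qed

lemma cone_weight_exists:
  assumes w: "w \<in> ground M \<rightarrow>\<^sub>E UNIV" and nz: "chi (init_matroid M w) \<noteq> 0"
  obtains \<S> c where "nested M \<G> \<S>" "c \<in> \<S> \<rightarrow>\<^sub>E {0<..}" "w = cone_weight (ground M) \<S> c"
proof -
  obtain c where c: "nested M \<G> (supp c)" "\<forall>e\<in>ground M. val c e = w e"
    using decomposition_exists[of w] superlevel_flat[OF nz] by auto
  show thesis
  proof
    show "nested M \<G> (supp c)" by fact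
    show "restrict c (supp c) \<in> supp c \<rightarrow>\<^sub>E {0<..}" by (auto simp: supp_def)
    show "w = cone_weight (ground M) (supp c) (restrict c (supp c))"
    proof (rule PiE_ext[OF w])
      show "cone_weight (ground M) (supp c) (restrict c (supp c)) \<in> ground M \<rightarrow>\<^sub>E UNIV"
        unfolding cone_weight_def by simp
      fix e assume e: "e \<in> ground M"
      have "cone_vector (supp c) (restrict c (supp c)) e = val c e"
        unfolding cone_vector_def val_def
        by (rule sum.mono_neutral_cong_left) (use finite_building in \<open>auto simp: supp_def\<close>)
      then show "w e = cone_weight (ground M) (supp c) (restrict c (supp c)) e"
        using c(2) e unfolding cone_weight_def by simp
    qed
  qed
qed

text \<open>If the members cover the ground set, the factors of the ground set are the maximal
  members; conversely these factors already cover it. This translates positivity of a weight into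
  the condition defining \<open>nested_sets_star\<close>.\<close>

lemma ground_subset_Union_nested:
  assumes S: "nested M \<G> \<S>"
  shows "ground M \<subseteq> \<Union>\<S> \<longleftrightarrow> fact_set \<G> (ground M) \<subseteq> \<S>"
proof
  assume "ground M \<subseteq> \<Union>\<S>"
  then have "ground M = \<Union>\<S>" using nested_building[OF S] building_ground by blast
  then show "fact_set \<G> (ground M) \<subseteq> \<S>"
    using fact_Union_nested[OF S] unfolding maximal_sets_def by auto
next
  assume "fact_set \<G> (ground M) \<subseteq> \<S>"
  then show "ground M \<subseteq> \<Union>\<S>" using Union_fact[OF ground_in_flats] by blast
qed

end

section \<open>The contribution of one nested set, and summation over a family of nested
  sets\<close>

lemma qvar_nonzero: "qvar \<noteq> 0" "qvar - 1 \<noteq> 0"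
proof -
  show "qvar \<noteq> 0" unfolding qvar_def by simp
  have "qvar - 1 = to_fract ([:0, 1:] - 1)" unfolding qvar_def by (simp only: to_fract_diff to_fract_1)
  also have "\<dots> \<noteq> 0" by (simp add: one_pCons)
  finally show "qvar - 1 \<noteq> 0" .
qed

lemma powi_minus_of_nat: "(x :: 'c::field) powi (- int n) = inverse x ^ n"
  by (simp add: power_int_minus power_inverse)

lemma qvar_powi_step: "qvar powi (1 - r - k) = qvar * qvar powi (- r - k)"
proof -
  have "1 - r - k = 1 + (- r - k)" by simp
  then show ?thesis using power_int_add[of qvar 1 "- r - k"] qvar_nonzero(1) by (simp only: power_int_1_right) simp
qed

lemma zeta_coeff_alt: "zeta_coeff M w = chi (init_matroid M w) * inverse qvar ^ (rk M + wt M w)"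
proof -
  have "- int (rk M) - int (wt M w) = - int (rk M + wt M w)" by simp
  then show ?thesis unfolding zeta_coeff_def by (simp only: powi_minus_of_nat)
qed

lemma flat_monom_alt: "flat_monom M F = fps_const (inverse qvar ^ mrank M F) * fps_X ^ card F"
  unfolding flat_monom_def powi_minus_of_nat ..

abbreviation (input) nested_term :: "'a::finite matroid \<Rightarrow> 'a set set \<Rightarrow> int poly fract fps" where
  "nested_term M \<S> \<equiv> fps_const (chi (nested_matroid M \<S>) / (qvar - 1) ^ card \<S>) *
     (\<Prod>F\<in>\<S>. fps_const (qvar - 1) * (flat_monom M F / (1 - flat_monom M F)))"

text \<open>The scalar occurs once per member of S in the product and cancels against the
  denominator. With q - 1 as scalar, the term of a nested set is reduced to a characteristic
  polynomial times plain geometric series.\<close>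

lemma scaled_prod_cancel:
  fixes q a :: "'c::field"
  assumes "finite S" "q \<noteq> 0"
  shows "fps_const (a / q ^ card S) * (\<Prod>F\<in>S. fps_const q * y F) = fps_const a * (\<Prod>F\<in>S. y F)"
proof -
  have "(\<Prod>F\<in>S. fps_const q * y F) = fps_const (q ^ card S) * (\<Prod>F\<in>S. y F)"
    by (simp add: prod.distrib fps_const_power)
  then have "fps_const (a / q ^ card S) * (\<Prod>F\<in>S. fps_const q * y F) =
      fps_const (a / q ^ card S * q ^ card S) * (\<Prod>F\<in>S. y F)"
    by (simp only: mult.assoc[symmetric] fps_const_mult)
  then show ?thesis using assms by simp
qed

text \<open>On the cone of \<open>\<S>\<close> the size is \<Sum> c F * #F, the weight is \<Sum> c F
  * rk F and the initial matroid is constant, so each coefficient is a constant times a product over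
  F of powers with exponent c F.\<close>

lemma gen_fps_cone:
  fixes M :: "'a::finite matroid"
  assumes LB: "loopless_building M \<G>" and S: "nested M \<G> \<S>"
  shows "finite_fibers (\<S> \<rightarrow>\<^sub>E {0<..}) (\<lambda>c. \<Sum>e\<in>ground M. cone_weight (ground M) \<S> c e) \<and>
    gen_fps (\<S> \<rightarrow>\<^sub>E {0<..}) (\<lambda>c. zeta_coeff M (cone_weight (ground M) \<S> c))
      (\<lambda>c. \<Sum>e\<in>ground M. cone_weight (ground M) \<S> c e) =
    fps_const (inverse qvar ^ rk M) * nested_term M \<S>"
proof -
  interpret loopless_building M \<G> by fact
  have fin: "finite \<S>" by (rule nested_finite[OF S])
  let ?P = "\<S> \<rightarrow>\<^sub>E {0<..} :: ('a set \<Rightarrow> nat) set"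
  have size: "(\<Sum>e\<in>ground M. cone_weight (ground M) \<S> c e) = (\<Sum>F\<in>\<S>. c F * card F)" for c
  proof -
    have "F \<inter> ground M = F" if "F \<in> \<S>" for F
      using that nested_building[OF S] building_ground by auto
    then have "(\<Sum>F\<in>\<S>. of_nat (card (F \<inter> ground M)) * c F) = (\<Sum>F\<in>\<S>. c F * card F)"
      by (intro sum.cong) auto
    then show ?thesis unfolding cone_weight_def
      using sum_cone_vector[OF fin finite_ground, of c] by simp
  qed
  have coeff: "zeta_coeff M (cone_weight (ground M) \<S> c) =
      chi (nested_matroid M \<S>) * inverse qvar ^ rk M * (\<Prod>F\<in>\<S>. (inverse qvar ^ mrank M F) ^ c F)"
    if c: "c \<in> ?P" for c
  proof -
    have pos: "F \<in> \<S> \<Longrightarrow> 0 < c F" for F using c by (auto simp: PiE_iff)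
    have eq: "e \<in> ground M \<Longrightarrow> cone_weight (ground M) \<S> c e = cone_vector \<S> c e" for e
      unfolding cone_weight_def by simp
    have "init_matroid M (cone_weight (ground M) \<S> c) = nested_matroid M \<S>"
      using init_matroid_nested(2)[OF S pos eq] nested_matroid_eq[OF LB S] by simp
    moreover have "wt M (cone_weight (ground M) \<S> c) = (\<Sum>F\<in>\<S>. mrank M F * c F)"
      using wt_nested[OF S pos eq] by simp
    ultimately show ?thesis
      unfolding zeta_coeff_alt by (simp only: power_add power_sum power_mult mult.assoc)
  qed
  have card: "0 < card F" if "F \<in> \<S>" for F
  proof -
    have "F \<noteq> {}" using that nested_building[OF S] building_nonempty by auto
    then show ?thesis by (simp add: card_gt_0_iff)
  qed
  have PiE: "finite_fibers ?P (\<lambda>c. \<Sum>F\<in>\<S>. c F * card F)"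
    "gen_fps ?P (\<lambda>c. \<Prod>F\<in>\<S>. (inverse qvar ^ mrank M F) ^ c F) (\<lambda>c. \<Sum>F\<in>\<S>. c F * card F) =
      (\<Prod>F\<in>\<S>. flat_monom M F / (1 - flat_monom M F))"
    using gen_fps_PiE[OF fin, of card "\<lambda>F. inverse qvar ^ mrank M F"] card
    unfolding flat_monom_alt by simp_all
  have "gen_fps ?P (\<lambda>c. zeta_coeff M (cone_weight (ground M) \<S> c))
      (\<lambda>c. \<Sum>e\<in>ground M. cone_weight (ground M) \<S> c e) =
    gen_fps ?P (\<lambda>c. chi (nested_matroid M \<S>) * inverse qvar ^ rk M *
        (\<Prod>F\<in>\<S>. (inverse qvar ^ mrank M F) ^ c F)) (\<lambda>c. \<Sum>F\<in>\<S>. c F * card F)"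
    by (rule gen_fps_cong) (simp_all only: size coeff)
  also have "\<dots> = fps_const (chi (nested_matroid M \<S>) * inverse qvar ^ rk M) *
      (\<Prod>F\<in>\<S>. flat_monom M F / (1 - flat_monom M F))"
    unfolding gen_fps_cmult PiE(2) ..
  also have "\<dots> = fps_const (inverse qvar ^ rk M) *
      (fps_const (chi (nested_matroid M \<S>)) * (\<Prod>F\<in>\<S>. flat_monom M F / (1 - flat_monom M F)))"
    by (simp only: mult.assoc[symmetric] fps_const_mult mult.commute)
  finally show ?thesis
    using PiE(1) unfolding size scaled_prod_cancel[OF fin qvar_nonzero(2)] by simp
qed

text \<open>The index set W is kept abstract so that all three identities are instances. The
  hypothesis \<open>mem\<close> says that a cone weight lies in W exactly when its nested set is in
  N; weights of W outside all cones have coefficient 0.\<close>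

lemma gen_fps_nested:
  fixes M :: "'a::finite matroid"
  assumes LB: "loopless_building M \<G>" and N: "N \<subseteq> nested_sets M \<G>" and W: "W \<subseteq> ground M \<rightarrow>\<^sub>E UNIV"
    and mem: "\<And>\<S> c. \<S> \<in> nested_sets M \<G> \<Longrightarrow> c \<in> \<S> \<rightarrow>\<^sub>E {0<..} \<Longrightarrow>
      cone_weight (ground M) \<S> c \<in> W \<longleftrightarrow> \<S> \<in> N"
  shows "gen_fps W (zeta_coeff M) (\<lambda>w. \<Sum>e\<in>ground M. w e) =
    fps_const (qvar powi (- int (rk M))) * (\<Sum>\<S>\<in>N. nested_term M \<S>)"
proof -
  interpret loopless_building M \<G> by fact
  let ?V = "SIGMA \<S>:N. \<S> \<rightarrow>\<^sub>E {0<..}"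
  let ?h = "\<lambda>(\<S>, c). cone_weight (ground M) \<S> c"
  let ?s = "\<lambda>w :: 'a \<Rightarrow> nat. \<Sum>e\<in>ground M. w e"
  have nest: "nested M \<G> \<S>" if "\<S> \<in> N" for \<S> using that N unfolding nested_sets_def by auto
  have inj: "inj_on ?h ?V" by (rule inj_on_subset[OF inj_cone_weight]) (use N in auto)
  have fib: "finite_fibers W ?s" unfolding finite_fibers_def
  proof
    fix n show "finite {w \<in> W. ?s w = n}"
      by (rule finite_subset[OF _ finite_weights[OF finite_ground, of n]]) (use W in auto)
  qed
  have "gen_fps W (zeta_coeff M) ?s = gen_fps (?h ` ?V) (zeta_coeff M) ?s"
  proof (rule gen_fps_mono_neutral[OF fib])
    show "?h ` ?V \<subseteq> W" using mem N by auto
    fix w assume w: "w \<in> W - ?h ` ?V"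
    show "zeta_coeff M w = 0"
    proof (rule ccontr)
      assume "zeta_coeff M w \<noteq> 0"
      then have "chi (init_matroid M w) \<noteq> 0" unfolding zeta_coeff_def by auto
      then obtain \<S> c where Sc: "nested M \<G> \<S>" "c \<in> \<S> \<rightarrow>\<^sub>E {0<..}" "w = cone_weight (ground M) \<S> c"
        using cone_weight_exists[of w] w subsetD[OF W, of w] by blast
      then have "\<S> \<in> N" using mem[of \<S> c] w unfolding nested_sets_def by auto
      then show False using w Sc by auto
    qed
  qed
  also have "\<dots> = gen_fps ?V (\<lambda>(\<S>, c). zeta_coeff M (cone_weight (ground M) \<S> c))
      (\<lambda>(\<S>, c). ?s (cone_weight (ground M) \<S> c))"
    unfolding gen_fps_reindex[OF inj] by (rule gen_fps_cong) auto
  also have "\<dots> = (\<Sum>\<S>\<in>N. gen_fps (\<S> \<rightarrow>\<^sub>E {0<..}) (\<lambda>c. zeta_coeff M (cone_weight (ground M) \<S> c))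
      (\<lambda>c. ?s (cone_weight (ground M) \<S> c)))"
    by (rule gen_fps_Sigma[OF finite_subset[OF N finite_nested_sets]])
      (use gen_fps_cone[OF LB nest] in auto)
  also have "\<dots> = (\<Sum>\<S>\<in>N. fps_const (inverse qvar ^ rk M) * nested_term M \<S>)"
    by (rule sum.cong[OF refl]) (use gen_fps_cone[OF LB nest] in auto)
  finally show ?thesis unfolding powi_minus_of_nat sum_distrib_left .
qed


section \<open>Weights modulo the all-ones vector\<close>

definition class_of :: "'a set \<Rightarrow> ('a \<Rightarrow> nat) \<Rightarrow> ('a \<Rightarrow> int) set" where
  "class_of E w = shift_rel E `` {\<lambda>e\<in>E. int (w e)}"

definition zero_min :: "'a set \<Rightarrow> ('a \<Rightarrow> nat) set" where
  "zero_min E = {w \<in> E \<rightarrow>\<^sub>E UNIV. \<exists>e\<in>E. w e = 0}"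

lemma class_of_lattice: "class_of E w \<in> lattice_mod_ones E"
  unfolding class_of_def lattice_mod_ones_def by (rule quotientI) simp

text \<open>The chosen lift differs from w by a constant, and as w takes the value 0 this constant
  is the minimum of the lift.\<close>

lemma lift_class_of:
  assumes E: "finite E" and w: "w \<in> zero_min E"
  shows "e \<in> E \<Longrightarrow> lift (class_of E w) e = int (w e) + Min (lift (class_of E w) ` E)"
proof -
  let ?l = "lift (class_of E w)"
  have "(\<lambda>e\<in>E. int (w e), ?l) \<in> shift_rel E"
    using lift_in(1)[OF class_of_lattice, of E w] unfolding class_of_def by simp
  then obtain k where k: "\<And>e. e \<in> E \<Longrightarrow> ?l e = int (w e) + k"
    unfolding shift_rel_def by auto
  obtain z where z: "z \<in> E" "w z = 0" using w unfolding zero_min_def by auto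
  have "Min (?l ` E) = k"
    by (rule Min_eqI) (use E k z in \<open>auto intro!: image_eqI[of _ _ z]\<close>)
  then show "e \<in> E \<Longrightarrow> ?l e = int (w e) + Min (?l ` E)" using k by simp
qed

text \<open>Subtracting the minimum picks the unique natural representative with a zero. For empty E
  there is one class but no such representative, whence the nonemptiness condition.\<close>

lemma bij_class_of:
  assumes E: "finite E" "E \<noteq> {}"
  shows "bij_betw (class_of E) (zero_min E) (lattice_mod_ones E)"
  unfolding bij_betw_def
proof
  show "inj_on (class_of E) (zero_min E)"
  proof (rule inj_onI)
    fix w w' assume w: "w \<in> zero_min E" "w' \<in> zero_min E" and eq: "class_of E w = class_of E w'"
    have "w e = w' e" if "e \<in> E" for e
      using lift_class_of[OF E(1) w(1) that] lift_class_of[OF E(1) w(2) that] eq by simp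
    then show "w = w'" using w unfolding zero_min_def by (auto intro: PiE_ext)
  qed
  show "class_of E ` zero_min E = lattice_mod_ones E"
  proof
    show "class_of E ` zero_min E \<subseteq> lattice_mod_ones E" using class_of_lattice by auto
    show "lattice_mod_ones E \<subseteq> class_of E ` zero_min E"
    proof
      fix v assume v: "v \<in> lattice_mod_ones E"
      define m where "m = Min (lift v ` E)"
      define w where "w = (\<lambda>e\<in>E. nat (lift v e - m))"
      have le: "m \<le> lift v e" if "e \<in> E" for e using that E(1) unfolding m_def by simp
      have "m \<in> lift v ` E" unfolding m_def using E by (intro Min_in) auto
      then obtain z where "z \<in> E" "lift v z = m" by auto
      then have "w \<in> zero_min E" unfolding zero_min_def w_def by auto
      moreover have "(lift v, \<lambda>e\<in>E. int (w e)) \<in> shift_rel E"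
        unfolding shift_rel_def using lift_in(2)[OF v] le
        by (auto simp: w_def intro!: exI[of _ "- m"])
      then have "v = class_of E w"
        unfolding class_of_def using lift_in(3)[OF v] equiv_class_eq[OF equiv_shift_rel] by metis
      ultimately show "v \<in> class_of E ` zero_min E" by auto
    qed
  qed
qed

text \<open>All bases have \<open>rk M\<close> elements, so a constant shift moves all their weights
  by the same amount and preserves the maximisers.\<close>

lemma (in matroid) shifted_weight:
  fixes w :: "'a \<Rightarrow> nat" and l :: "'a \<Rightarrow> int"
  assumes l: "\<And>e. e \<in> ground M \<Longrightarrow> l e = int (w e) + k"
  shows wt_shift: "wt M l = int (wt M w) + int (rk M) * k"
    and init_matroid_shift: "init_matroid M l = init_matroid M w"
proof -
  have sum: "(\<Sum>e\<in>B. l e) = int (\<Sum>e\<in>B. w e) + int (rk M) * k" if "B \<in> bases M" for B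
  proof -
    have "(\<Sum>e\<in>B. l e) = (\<Sum>e\<in>B. int (w e) + k)"
      using l bases_ground[OF that] by (intro sum.cong) auto
    then show ?thesis by (simp add: sum.distrib mrank_ground[OF that])
  qed
  have "wt M w \<in> (\<lambda>B. \<Sum>e\<in>B. w e) ` bases M"
    unfolding wt_def using finite_bases bases_nonempty by (intro Max_in) auto
  then obtain B where B: "B \<in> bases M" "(\<Sum>e\<in>B. w e) = wt M w" by auto
  show wt: "wt M l = int (wt M w) + int (rk M) * k"
  proof (rule wt_eqI[OF B(1)])
    show "(\<Sum>e\<in>B. l e) = int (wt M w) + int (rk M) * k" using sum[OF B(1)] B(2) by simp
    fix B' assume B': "B' \<in> bases M"
    show "(\<Sum>e\<in>B'. l e) \<le> int (wt M w) + int (rk M) * k"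
      unfolding sum[OF B'] using weight_le_wt[OF B', of w] by (simp del: of_nat_sum)
  qed
  have "(\<Sum>e\<in>B. l e) = wt M l \<longleftrightarrow> (\<Sum>e\<in>B. w e) = wt M w" if "B \<in> bases M" for B
    unfolding wt sum[OF that] by (simp del: of_nat_sum)
  then have "{B \<in> bases M. (\<Sum>e\<in>B. l e) = wt M l} = {B \<in> bases M. (\<Sum>e\<in>B. w e) = wt M w}"
    by (intro Collect_cong) auto
  then show "init_matroid M l = init_matroid M w" unfolding init_matroid_def by simp
qed

text \<open>In the factor q / (q - 1), the numerator accounts for the exponent rk M - 1 in place of
  rk M, and the denominator for the reduced characteristic polynomial. The shift of the weight by
  the minimum of the lift cancels in \<open>wt_bar\<close>.\<close>

lemma (in matroid) zeta_bar_alt: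
  assumes ne: "ground M \<noteq> {}"
  shows "zeta_bar M = fps_const (qvar / (qvar - 1)) *
    gen_fps (zero_min (ground M)) (zeta_coeff M) (\<lambda>w. \<Sum>e\<in>ground M. w e)"
proof -
  let ?E = "ground M"
  have size: "size_bar M (class_of ?E w) = int (\<Sum>e\<in>?E. w e)" if w: "w \<in> zero_min ?E" for w
    unfolding size_bar_def using lift_class_of[OF finite_ground w] by (simp add: sum.distrib)
  have coeff: "zeta_coeff_bar M (class_of ?E w) = qvar / (qvar - 1) * zeta_coeff M w"
    if w: "w \<in> zero_min ?E" for w
  proof -
    let ?l = "lift (class_of ?E w)"
    have sh: "wt M ?l = int (wt M w) + int (rk M) * Min (?l ` ?E)" "init_matroid M ?l = init_matroid M w"
      by (rule shifted_weight, rule lift_class_of[OF finite_ground w], assumption)+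
    show ?thesis
      unfolding zeta_coeff_bar_def zeta_coeff_def chi_bar_def wt_bar_def init_matroid_bar_def sh
      by (simp add: qvar_powi_step)
  qed
  have bij: "inj_on (class_of ?E) (zero_min ?E)" "class_of ?E ` zero_min ?E = lattice_mod_ones ?E"
    using bij_class_of[OF finite_ground ne] unfolding bij_betw_def by auto
  show ?thesis
  proof (rule fps_ext)
    fix n
    have "{v \<in> lattice_mod_ones ?E. size_bar M v = int n} =
      class_of ?E ` {w \<in> zero_min ?E. (\<Sum>e\<in>?E. w e) = n}"
      unfolding bij(2)[symmetric] using size by (auto simp del: of_nat_sum)
    then have "fps_nth (zeta_bar M) n =
      (\<Sum>v\<in>class_of ?E ` {w \<in> zero_min ?E. (\<Sum>e\<in>?E. w e) = n}. zeta_coeff_bar M v)"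
      unfolding zeta_bar_def by simp
    also have "\<dots> = (\<Sum>w\<in>{w \<in> zero_min ?E. (\<Sum>e\<in>?E. w e) = n}. zeta_coeff_bar M (class_of ?E w))"
      by (subst sum.reindex) (auto intro: inj_on_subset[OF bij(1)])
    also have "\<dots> = (\<Sum>w\<in>{w \<in> zero_min ?E. (\<Sum>e\<in>?E. w e) = n}. qvar / (qvar - 1) * zeta_coeff M w)"
      by (rule sum.cong) (auto simp: coeff)
    finally show "fps_nth (zeta_bar M) n = fps_nth (fps_const (qvar / (qvar - 1)) *
      gen_fps (zero_min ?E) (zeta_coeff M) (\<lambda>w. \<Sum>e\<in>?E. w e)) n"
      by (simp add: gen_fps_nth sum_distrib_left)
  qed
qed

lemma zeta_gen_fps:
  "zeta M = gen_fps (ground M \<rightarrow>\<^sub>E UNIV) (zeta_coeff M) (\<lambda>w. \<Sum>e\<in>ground M. w e)"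
  "zeta0 M = gen_fps (ground M \<rightarrow>\<^sub>E {0<..}) (zeta_coeff M) (\<lambda>w. \<Sum>e\<in>ground M. w e)"
  unfolding zeta_def zeta0_def gen_fps_def by simp_all

theorem theorem9p1:
  fixes M :: "'a::finite matroid" and \<G> :: "'a set set"
  assumes "is_matroid M" and "building_set M \<G>"
  shows "zeta M = fps_const (qvar powi (- int (rk M))) *
           (\<Sum>\<S>\<in>nested_sets M \<G>.
              fps_const (chi (nested_matroid M \<S>) / (qvar - 1) ^ card \<S>) *
              (\<Prod>F\<in>\<S>. fps_const (qvar - 1) * (flat_monom M F / (1 - flat_monom M F))))
       \<and> zeta0 M = fps_const (qvar powi (- int (rk M))) *
           (\<Sum>\<S>\<in>nested_sets_star M \<G>.
              fps_const (chi (nested_matroid M \<S>) / (qvar - 1) ^ card \<S>) *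
              (\<Prod>F\<in>\<S>. fps_const (qvar - 1) * (flat_monom M F / (1 - flat_monom M F))))
       \<and> (ground M \<noteq> {} \<longrightarrow>
         zeta_bar M = fps_const (qvar powi (- (int (rk M) - 1))) *
           (\<Sum>\<S>\<in>nested_sets_circ M \<G>.
              fps_const (chi_bar (nested_matroid M \<S>) / (qvar - 1) ^ card \<S>) *
              (\<Prod>F\<in>\<S>. fps_const (qvar - 1) * (flat_monom M F / (1 - flat_monom M F)))))"
proof -
  interpret matroid M by standard fact
  show ?thesis
  proof (cases "mcl M {} = {}")
    case False
    \<comment> \<open>An initial matroid only discards bases, so a loop of M stays a loop and every
      characteristic polynomial on either side is 0.\<close>
    then have "zeta_coeff M w = 0" for w unfolding zeta_coeff_def by (simp add: chi_init_loop)
    then have "gen_fps W (zeta_coeff M) s = 0" for W s by (intro fps_ext) (simp add: gen_fps_nth)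
    moreover have "chi (nested_matroid M \<S>) = 0" for \<S>
      unfolding nested_matroid_def by (rule chi_init_loop[OF False])
    ultimately show ?thesis by (simp add: zeta_gen_fps zeta_bar_alt chi_bar_def)
  next
    case True
    have LB: "loopless_building M \<G>" by unfold_locales (use assms True in auto)
    then interpret loopless_building M \<G> .
    have pos: "0 < cone_weight (ground M) \<S> c e \<longleftrightarrow> e \<in> \<Union>\<S>"
      if "\<S> \<in> nested_sets M \<G>" "c \<in> \<S> \<rightarrow>\<^sub>E {0<..}" "e \<in> ground M" for \<S> c e
    proof -
      have "finite \<S>" using that(1) nested_finite unfolding nested_sets_def by auto
      moreover have "\<And>F. F \<in> \<S> \<Longrightarrow> 0 < c F" using that(2) by (auto simp: PiE_iff)
      ultimately show ?thesis using cone_vector_pos[of \<S> c e] that(3) unfolding cone_weight_def by simp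
    qed
    have ext: "cone_weight (ground M) \<S> c \<in> ground M \<rightarrow>\<^sub>E UNIV" for \<S> c
      unfolding cone_weight_def by simp
    have star: "cone_weight (ground M) \<S> c \<in> ground M \<rightarrow>\<^sub>E {0<..} \<longleftrightarrow> \<S> \<in> nested_sets_star M \<G>"
      if S: "\<S> \<in> nested_sets M \<G>" "c \<in> \<S> \<rightarrow>\<^sub>E {0<..}" for \<S> c
    proof -
      have "cone_weight (ground M) \<S> c \<in> ground M \<rightarrow>\<^sub>E {0<..} \<longleftrightarrow> ground M \<subseteq> \<Union>\<S>"
        using ext[of \<S> c] pos[OF S] unfolding PiE_iff subset_eq by auto
      also have "\<dots> \<longleftrightarrow> \<S> \<in> nested_sets_star M \<G>"
        using ground_subset_Union_nested[of \<S>] S(1) unfolding nested_sets_star_def nested_sets_def by simp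
      finally show ?thesis .
    qed
    \<comment> \<open>A natural weight that is not positive everywhere takes the value 0 somewhere,
      so this is the complement of \<open>star\<close>.\<close>
    have circ: "cone_weight (ground M) \<S> c \<in> zero_min (ground M) \<longleftrightarrow> \<S> \<in> nested_sets_circ M \<G>"
      if S: "\<S> \<in> nested_sets M \<G>" "c \<in> \<S> \<rightarrow>\<^sub>E {0<..}" for \<S> c
    proof -
      have "cone_weight (ground M) \<S> c \<in> zero_min (ground M) \<longleftrightarrow>
          cone_weight (ground M) \<S> c \<notin> ground M \<rightarrow>\<^sub>E {0<..}"
        using ext[of \<S> c] unfolding zero_min_def PiE_iff by auto
      then show ?thesis using star[OF S] S(1) unfolding nested_sets_circ_def by simp
    qed
    have bar: "zeta_bar M = fps_const (qvar powi (- (int (rk M) - 1))) *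
        (\<Sum>\<S>\<in>nested_sets_circ M \<G>.
          fps_const (chi_bar (nested_matroid M \<S>) / (qvar - 1) ^ card \<S>) *
          (\<Prod>F\<in>\<S>. fps_const (qvar - 1) * (flat_monom M F / (1 - flat_monom M F))))"
      if ne: "ground M \<noteq> {}"
    proof -
      let ?Y = "\<lambda>\<S>. \<Prod>F\<in>\<S>. fps_const (qvar - 1) * (flat_monom M F / (1 - flat_monom M F))"
      \<comment> \<open>The factor q / (q - 1) of \<open>zeta_bar_alt\<close> is split: q is
        absorbed into the power in front, and 1 / (q - 1) turns \<open>chi\<close> into
        \<open>chi_bar\<close>.\<close>
      have pow: "qvar powi (- (int (rk M) - 1)) = qvar * qvar powi (- int (rk M))"
        using qvar_powi_step[of "int (rk M)" 0] by simp
      have "gen_fps (zero_min (ground M)) (zeta_coeff M) (\<lambda>w. \<Sum>e\<in>ground M. w e) =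
        fps_const (qvar powi (- int (rk M))) * (\<Sum>\<S>\<in>nested_sets_circ M \<G>. nested_term M \<S>)"
        by (rule gen_fps_nested[OF LB _ _ circ]) (auto simp: nested_sets_circ_def zero_min_def)
      then have "zeta_bar M = fps_const (qvar * qvar powi (- int (rk M))) *
          (fps_const (1 / (qvar - 1)) * (\<Sum>\<S>\<in>nested_sets_circ M \<G>. nested_term M \<S>))"
        unfolding zeta_bar_alt[OF ne] mult.assoc[symmetric] fps_const_mult by (simp add: mult.commute)
      also have "fps_const (1 / (qvar - 1)) * (\<Sum>\<S>\<in>nested_sets_circ M \<G>. nested_term M \<S>) =
          (\<Sum>\<S>\<in>nested_sets_circ M \<G>.
            fps_const (chi_bar (nested_matroid M \<S>) / (qvar - 1) ^ card \<S>) * ?Y \<S>)"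
        unfolding sum_distrib_left mult.assoc[symmetric] fps_const_mult chi_bar_def
        by (intro sum.cong refl) (simp add: mult.commute)
      finally show ?thesis unfolding pow .
    qed
    have "zeta M = fps_const (qvar powi (- int (rk M))) * (\<Sum>\<S>\<in>nested_sets M \<G>. nested_term M \<S>)"
      unfolding zeta_gen_fps by (rule gen_fps_nested[OF LB]) (use ext in auto)
    moreover have "zeta0 M = fps_const (qvar powi (- int (rk M))) *
        (\<Sum>\<S>\<in>nested_sets_star M \<G>. nested_term M \<S>)"
      unfolding zeta_gen_fps
      by (rule gen_fps_nested[OF LB _ _ star]) (auto simp: nested_sets_star_def)
    ultimately show ?thesis using bar by simp
  qed
qed

end
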